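(* Let $1\le m<n$ be integers and write $X=(x,y)\in\mathbb{R}^m\times\mathbb{R}^{n-m}=\mathbb{R}^n$. Let $f$, $\alpha$, $p$ satisfy the structural assumptions listed in the context. Let $u:\mathbb{R}^n\to\mathbb{R}$ satisfy $u\in C^1(\mathbb{R}^n)\cap C^2(\{\nabla u\neq 0\})\cap L^\infty(\mathbb{R}^n)$ and $\nabla u\in L^\infty(\mathbb{R}^n)\cap W^{1,2}_{\rm loc}(\mathbb{R}^n)$, and let $u$ be a weak solution in the whole of $\mathbb{R}^n$ of $$-{\rm div}\big(\alpha(x)|\nabla u(X)|^{p(x)-2}\nabla u(X)\big)=f(x,u(X)).$$ Suppose that $\partial_{y_1}u(X)>0$ for every $X\in\mathbb{R}^n$, and that there exists $C_o\ge 1$ such that $$\int_{B_R}\alpha(x)|\nabla u|^{p(x)}\,dX\le C_o\,R^2\qquad\text{for every }R\ge C_o .$$ Then there exist $\omega\in{\rm S}^{n-m-1}$ and $u_o:\mathbb{R}^m\times\mathbb{R}\to\mathbb{R}$ such that $$u(x,y)=u_o(x,\omega\cdot y)\qquad\text{for every }(x,y)\in\mathbb{R}^m\times\mathbb{R}^{n-m}.$$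
   Context: Structural assumptions: $f=f(x,u)\in L^\infty(\mathbb{R}^m\times\mathbb{R})$ is differentiable in $u$ with $f_u\in L^\infty(\mathbb{R}^m\times\mathbb{R})$; $\alpha\in L^\infty(\mathbb{R}^m)$ with $\inf_{\mathbb{R}^m}\alpha>0$; $p\in L^\infty(\mathbb{R}^m)$ with $p(x)\ge 2$ for every $x\in\mathbb{R}^m$. Weak solution in $\mathbb{R}^n$: $\int_{\mathbb{R}^n}\alpha(x)|\nabla u|^{p(x)-2}\nabla u\cdot\nabla\xi\,dX=\int_{\mathbb{R}^n}f(x,u)\,\xi\,dX$ for every $\xi\in C^\infty_0(\mathbb{R}^n)$. $B_R$ is the ball of radius $R$ centered at the origin of $\mathbb{R}^n$, ${\rm S}^{n-m-1}$ is the unit sphere of $\mathbb{R}^{n-m}$, and $y=(y_1,\dots,y_{n-m})$. *)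

theory Defs
  imports "HOL-Analysis.Analysis"
begin

(* Meant for open S: k times differentiable on S, with continuous iterated
   directional derivatives of order k. *)
primrec Ck_on :: "nat \<Rightarrow> 'a::euclidean_space set \<Rightarrow> ('a \<Rightarrow> real) \<Rightarrow> bool" where
  "Ck_on 0 S g \<longleftrightarrow> continuous_on S g"
| "Ck_on (Suc k) S g \<longleftrightarrow>
     (\<forall>x\<in>S. g differentiable (at x)) \<and>
     (\<forall>v. Ck_on k S (\<lambda>x. frechet_derivative g (at x) v))"

definition test_function :: "('a::euclidean_space \<Rightarrow> real) \<Rightarrow> bool" where
  "test_function \<xi> \<longleftrightarrow> (\<forall>k. Ck_on k UNIV \<xi>) \<and> compact (closure {x. \<xi> x \<noteq> 0})"

definition grad :: "('a::euclidean_space \<Rightarrow> real) \<Rightarrow> 'a \<Rightarrow> 'a" where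
  "grad g x = (\<Sum>b\<in>Basis. frechet_derivative g (at x) b *\<^sub>R b)"

definition Linfty :: "('a::euclidean_space \<Rightarrow> 'b::euclidean_space) \<Rightarrow> bool" where
  "Linfty g \<longleftrightarrow> g \<in> borel_measurable lebesgue \<and> (\<exists>C. AE x in lebesgue. norm (g x) \<le> C)"

definition L2_loc :: "('a::euclidean_space \<Rightarrow> real) \<Rightarrow> bool" where
  "L2_loc g \<longleftrightarrow> g \<in> borel_measurable lebesgue \<and>
     (\<forall>K. compact K \<longrightarrow> set_integrable lebesgue K (\<lambda>x. (g x)\<^sup>2))"

definition weak_partial :: "'a::euclidean_space \<Rightarrow> ('a \<Rightarrow> real) \<Rightarrow> ('a \<Rightarrow> real) \<Rightarrow> bool" where
  "weak_partial b g h \<longleftrightarrow>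
     (\<forall>\<xi>. test_function \<xi> \<longrightarrow>
        (LINT x|lebesgue. g x * frechet_derivative \<xi> (at x) b) = - (LINT x|lebesgue. h x * \<xi> x))"

definition W12_loc :: "('a::euclidean_space \<Rightarrow> real) \<Rightarrow> bool" where
  "W12_loc g \<longleftrightarrow> L2_loc g \<and> (\<forall>b\<in>Basis. \<exists>h. L2_loc h \<and> weak_partial b g h)"

definition W12_loc_vec :: "('a::euclidean_space \<Rightarrow> 'b::euclidean_space) \<Rightarrow> bool" where
  "W12_loc_vec G \<longleftrightarrow> (\<forall>b\<in>Basis. W12_loc (\<lambda>x. G x \<bullet> b))"

(* The infimum of alpha is taken in the extended reals, since the real INF is
   unspecified for functions that are not bounded below. *)
definition structural ::
  "(real^'m \<Rightarrow> real \<Rightarrow> real) \<Rightarrow> (real^'m \<Rightarrow> real) \<Rightarrow> (real^'m \<Rightarrow> real) \<Rightarrow> bool" where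
  "structural f \<alpha> p \<longleftrightarrow>
     Linfty (\<lambda>(x, s). f x s) \<and>
     (\<forall>x s. f x differentiable (at s)) \<and>
     Linfty (\<lambda>(x, s). deriv (f x) s) \<and>
     Linfty \<alpha> \<and> (INF x. ereal (\<alpha> x)) > 0 \<and>
     Linfty p \<and> (\<forall>x. p x \<ge> 2)"

(* For u of class C1 with bounded gradient and data satisfying the structural assumptions
   both integrands are integrable, so the value 0 that the Bochner integral assigns to
   non-integrable functions plays no role.  The convention 0 powr 0 = 0 is harmless
   because the factor is multiplied by the gradient of u. *)
definition weak_solution ::
  "(real^'m \<Rightarrow> real \<Rightarrow> real) \<Rightarrow> (real^'m \<Rightarrow> real) \<Rightarrow> (real^'m \<Rightarrow> real) \<Rightarrow>
   ((real^'m) \<times> (real^'k) \<Rightarrow> real) \<Rightarrow> bool" where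
  "weak_solution f \<alpha> p u \<longleftrightarrow>
     (\<forall>\<xi>. test_function \<xi> \<longrightarrow>
        (LINT X|lebesgue. \<alpha> (fst X) * norm (grad u X) powr (p (fst X) - 2) * (grad u X \<bullet> grad \<xi> X))
        = (LINT X|lebesgue. f (fst X) (u X) * \<xi> X))"

end

theory Submission
  imports Defs
begin

text \<open>Since \<open>\<partial>\<^sub>y\<^sub>1 u > 0\<close>, the gradient never vanishes and \<open>u\<close> is of class \<open>C\<^sup>2\<close>. The data do not
  depend on \<open>y\<close>, so every derivative \<open>w = \<partial>\<^sub>z u\<close> in a \<open>y\<close>-direction \<open>z\<close> solves the same linearized
  equation as the positive function \<open>v = \<partial>\<^sub>y\<^sub>1 u\<close>. The quotient \<open>\<sigma> = w / v\<close> then satisfies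
  \<open>div (v\<^sup>2 M \<nabla>\<sigma>) = 0\<close> with a positive definite symmetric matrix \<open>M\<close>, and the quadratic growth of the
  energy bounds that of \<open>\<integral>\<^bsub>B R\<^esub> (v \<sigma>)\<^sup>2 \<bar>M\<bar>\<close>. A Liouville argument of Berestycki, Caffarelli and
  Nirenberg shows that \<open>\<sigma>\<close> is constant. Hence \<open>\<nabla>\<^sub>y u\<close> is everywhere parallel to one fixed vector.\<close>

section \<open>Functions of class \<open>C\<^sup>1\<close> and their gradients\<close>

text \<open>The data are only measurable in x, so the equation cannot be differentiated pointwise.
  Translations along (0, z) do not affect the x-dependence of the data, so difference quotients of
  the weak form are used, with the shift moved onto the test function. The limit has the matrix M =
  \<alpha> |\<nabla>u|^(p-2) (I + (p-2) n n^T), n = \<nabla>u / |\<nabla>u|. Its zero-order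
  coefficient f_u(x, u) is the same for v and w and cancels once v is tested with w \<zeta> and w
  with v \<zeta>. Such test functions are merely C^1, whence the mollification. Quadratic growth is
  the borderline case: a cutoff between R and 2R has gradient of order 1/R, so the error term stays
  bounded but need not tend to 0. This bounds the total energy of \<sigma>; the cross term then sees
  only the energy on the annulus, which tends to 0 along doubling radii because the total is finite.
  The link to the assumed energy is that M has norm at most (p-1) \<alpha> |\<nabla>u|^(p-2), while
  w^2 \<le> |z|^2 |\<nabla>u|^2.\<close>

definition C1_grad :: "('a::euclidean_space \<Rightarrow> real) \<Rightarrow> ('a \<Rightarrow> 'a) \<Rightarrow> bool" where
  "C1_grad g G \<longleftrightarrow>
     (\<forall>x. (g has_derivative (\<lambda>h. G x \<bullet> h)) (at x)) \<and> continuous_on UNIV G"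

lemma C1_gradD: "C1_grad g G \<Longrightarrow> (g has_derivative (\<lambda>h. G x \<bullet> h)) (at x)"
  by (simp add: C1_grad_def)

lemma C1_grad_continuous: "C1_grad g G \<Longrightarrow> continuous_on UNIV g"
  by (rule has_derivative_continuous_on[OF has_derivative_at_withinI[OF C1_gradD]])

lemma C1_grad_continuous_grad: "C1_grad g G \<Longrightarrow> continuous_on UNIV G"
  by (simp add: C1_grad_def)

lemma C1_grad_frechet: "C1_grad g G \<Longrightarrow> frechet_derivative g (at x) v = G x \<bullet> v"
  by (simp add: frechet_derivative_at[OF C1_gradD, symmetric])

lemma grad_inner:
  assumes "g differentiable (at x)"
  shows "grad g x \<bullet> v = frechet_derivative g (at x) v"
proof -
  have lin: "linear (frechet_derivative g (at x))"
    using assms by (rule linear_frechet_derivative)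
  have "frechet_derivative g (at x) v
      = frechet_derivative g (at x) (\<Sum>b\<in>Basis. (v \<bullet> b) *\<^sub>R b)"
    by (simp add: euclidean_representation)
  also have "\<dots> = (\<Sum>b\<in>Basis. (v \<bullet> b) * frechet_derivative g (at x) b)"
    by (simp add: linear_sum[OF lin] linear_scale[OF lin])
  finally show ?thesis
    by (simp add: grad_def inner_sum_left inner_commute[of v] mult.commute)
qed

text \<open>Gradients are carried as an explicit second argument, so that product, quotient and
  chain rules yield closed formulas. This lemma translates back to \<open>grad\<close>, the form
  used in \<open>weak_solution\<close>.\<close>

lemma C1_grad_unique:
  assumes "C1_grad g G"
  shows "grad g x = G x"
proof -
  have "grad g x \<bullet> z = G x \<bullet> z" for z
    using grad_inner[OF differentiableI[OF C1_gradD[OF assms]]] C1_grad_frechet[OF assms] by simp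
  then show ?thesis using vector_eq_rdot by blast
qed

lemma Ck_on_1_C1_grad:
  assumes "Ck_on 1 UNIV g"
  shows "C1_grad g (grad g)"
proof -
  have d: "g differentiable (at x)" for x
    using assms by simp
  have "continuous_on UNIV (\<lambda>x. frechet_derivative g (at x) v)" for v
    using assms by simp
  then have "continuous_on UNIV (grad g)"
    unfolding grad_def by (intro continuous_intros)
  moreover have "(g has_derivative (\<lambda>h. grad g x \<bullet> h)) (at x)" for x
    using d[of x] by (simp add: grad_inner frechet_derivative_works[symmetric])
  ultimately show ?thesis
    by (simp add: C1_grad_def)
qed

text \<open>The strict inequality describes an open set, so the derivative there is that of the zero
  function. Compact support is expressed throughout as vanishing beyond some radius.\<close>

lemma C1_grad_zero_outside:
  assumes "C1_grad g G" "\<And>x. r < norm x \<Longrightarrow> g x = 0" "r < norm x"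
  shows "G x = 0"
proof -
  have "open {x::'a. r < norm x}"
    by (intro open_Collect_less continuous_intros)
  then have "(g has_derivative (\<lambda>h. 0)) (at x)"
    by (rule has_derivative_transform_within_open[OF has_derivative_const]) (use assms in auto)
  then have "(\<lambda>h. G x \<bullet> h) = (\<lambda>h. 0)"
    using C1_gradD[OF assms(1)] has_derivative_unique by blast
  then show ?thesis
    by (metis inner_eq_zero_iff)
qed

lemma C1_grad_mult:
  assumes "C1_grad f F" "C1_grad g G"
  shows "C1_grad (\<lambda>x. f x * g x) (\<lambda>x. f x *\<^sub>R G x + g x *\<^sub>R F x)"
  unfolding C1_grad_def
proof (intro conjI allI)
  show "((\<lambda>x. f x * g x) has_derivative (\<lambda>h. (f x *\<^sub>R G x + g x *\<^sub>R F x) \<bullet> h)) (at x)" for x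
    by (rule derivative_eq_intros C1_gradD[OF assms(1)] C1_gradD[OF assms(2)])+
      (simp add: fun_eq_iff algebra_simps)
qed (intro continuous_intros assms[THEN C1_grad_continuous] assms[THEN C1_grad_continuous_grad])

lemma C1_grad_divide:
  assumes "C1_grad f F" "C1_grad g G" and nz: "\<And>x. g x \<noteq> 0"
  shows "C1_grad (\<lambda>x. f x / g x) (\<lambda>x. (1 / (g x)\<^sup>2) *\<^sub>R (g x *\<^sub>R F x - f x *\<^sub>R G x))"
  unfolding C1_grad_def
proof (intro conjI allI)
  show "((\<lambda>x. f x / g x) has_derivative
      (\<lambda>h. ((1 / (g x)\<^sup>2) *\<^sub>R (g x *\<^sub>R F x - f x *\<^sub>R G x)) \<bullet> h)) (at x)" for x
    by (rule derivative_eq_intros C1_gradD[OF assms(1)] C1_gradD[OF assms(2)] nz)+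
      (use nz[of x] in \<open>simp add: fun_eq_iff divide_simps power2_eq_square inner_diff_left\<close>)
qed (intro continuous_intros assms(1,2)[THEN C1_grad_continuous]
    assms(1,2)[THEN C1_grad_continuous_grad], use nz in auto)

lemma C1_grad_compose:
  assumes "C1_grad g G" and h: "\<And>s. (h has_real_derivative h' s) (at s)"
    and "continuous_on UNIV h'"
  shows "C1_grad (\<lambda>x. h (g x)) (\<lambda>x. h' (g x) *\<^sub>R G x)"
  unfolding C1_grad_def
proof (intro conjI allI)
  have "(h has_derivative (*) (h' (g x))) (at (g x))" for x
    using h[of "g x"] by (simp add: has_field_derivative_def)
  from has_derivative_compose[OF C1_gradD[OF assms(1)] this]
  show "((\<lambda>x. h (g x)) has_derivative (\<lambda>v. (h' (g x) *\<^sub>R G x) \<bullet> v)) (at x)" for x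
    by simp
qed (intro continuous_intros continuous_on_compose2[OF assms(3)]
    C1_grad_continuous[OF assms(1)] C1_grad_continuous_grad[OF assms(1)] subset_UNIV)

lemma C1_grad_translate:
  assumes "C1_grad g G"
  shows "C1_grad (\<lambda>x. g (x + c)) (\<lambda>x. G (x + c))"
  unfolding C1_grad_def
proof (intro conjI allI)
  have "((\<lambda>x. x + c) has_derivative (\<lambda>h. h)) (at x)" for x :: 'a
    by (auto intro!: derivative_eq_intros)
  from has_derivative_compose[OF this C1_gradD[OF assms]]
  show "((\<lambda>x. g (x + c)) has_derivative (\<lambda>h. G (x + c) \<bullet> h)) (at x)" for x .
qed (intro continuous_on_compose2[OF C1_grad_continuous_grad[OF assms]] continuous_intros subset_UNIV)

lemma C1_grad_line:
  assumes "C1_grad g G"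
  shows "((\<lambda>t. g (x + t *\<^sub>R e)) has_real_derivative G (x + t *\<^sub>R e) \<bullet> e) (at t)"
proof -
  have "((\<lambda>t. x + t *\<^sub>R e) has_derivative (\<lambda>h. h *\<^sub>R e)) (at t)"
    by (auto intro!: derivative_eq_intros)
  from has_derivative_compose[OF this C1_gradD[OF assms]] show ?thesis
    by (simp add: has_field_derivative_def mult_commute_abs)
qed

text \<open>Symmetry of second derivatives, by applying the mean value theorem twice to
  \<open>u (x + s e + t d) - u (x + s e) - u (x + t d) + u x\<close> in either order.\<close>

lemma second_difference_mvt:
  fixes u :: "'a::euclidean_space \<Rightarrow> real"
  assumes u: "C1_grad u U" and d: "C1_grad (\<lambda>x. U x \<bullet> e) H" and r: "r > 0"
  shows "\<exists>s t. 0 < s \<and> s < r \<and> 0 < t \<and> t < r \<and>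
    u (x + r *\<^sub>R e + r *\<^sub>R d) - u (x + r *\<^sub>R e) - u (x + r *\<^sub>R d) + u x
      = r\<^sup>2 * (H (x + s *\<^sub>R e + t *\<^sub>R d) \<bullet> d)"
proof -
  define \<phi> where "\<phi> s = u (x + r *\<^sub>R d + s *\<^sub>R e) - u (x + s *\<^sub>R e)" for s
  have "\<exists>s. 0 < s \<and> s < r \<and>
      \<phi> r - \<phi> 0 = (r - 0) * (U (x + r *\<^sub>R d + s *\<^sub>R e) \<bullet> e - U (x + s *\<^sub>R e) \<bullet> e)"
    unfolding \<phi>_def using r by (intro MVT2) (auto intro!: DERIV_diff C1_grad_line[OF u])
  then obtain s where s: "0 < s" "s < r"
    "\<phi> r - \<phi> 0 = r * (U (x + r *\<^sub>R d + s *\<^sub>R e) \<bullet> e - U (x + s *\<^sub>R e) \<bullet> e)"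
    by auto
  have "\<exists>t. 0 < t \<and> t < r \<and>
      U ((x + s *\<^sub>R e) + r *\<^sub>R d) \<bullet> e - U ((x + s *\<^sub>R e) + 0 *\<^sub>R d) \<bullet> e
        = (r - 0) * (H ((x + s *\<^sub>R e) + t *\<^sub>R d) \<bullet> d)"
    using r by (intro MVT2) (auto intro!: C1_grad_line[OF d])
  then obtain t where t: "0 < t" "t < r"
    "U ((x + s *\<^sub>R e) + r *\<^sub>R d) \<bullet> e - U (x + s *\<^sub>R e) \<bullet> e
        = r * (H ((x + s *\<^sub>R e) + t *\<^sub>R d) \<bullet> d)"
    by auto
  have "\<phi> r - \<phi> 0 = r\<^sup>2 * (H (x + s *\<^sub>R e + t *\<^sub>R d) \<bullet> d)"
    unfolding s(3) using t(3) by (simp add: add_ac power2_eq_square)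
  then have "u (x + r *\<^sub>R e + r *\<^sub>R d) - u (x + r *\<^sub>R e) - u (x + r *\<^sub>R d) + u x
      = r\<^sup>2 * (H (x + s *\<^sub>R e + t *\<^sub>R d) \<bullet> d)"
    by (simp add: \<phi>_def algebra_simps)
  with s(1,2) t(1,2) show ?thesis by blast
qed

lemma second_derivative_symmetric:
  fixes u :: "'a::euclidean_space \<Rightarrow> real"
  assumes u: "C1_grad u U" and e: "C1_grad (\<lambda>x. U x \<bullet> e) H" and d: "C1_grad (\<lambda>x. U x \<bullet> d) K"
  shows "H x \<bullet> d = K x \<bullet> e"
proof -
  define r where "r n = inverse (real (Suc n))" for n
  have r: "r n > 0" for n by (simp add: r_def)
  have r0: "r \<longlonglongrightarrow> 0" unfolding r_def by (rule LIMSEQ_inverse_real_of_nat)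
  have "\<forall>n. \<exists>s t s' t'. 0 < s \<and> s < r n \<and> 0 < t \<and> t < r n \<and> 0 < s' \<and> s' < r n \<and> 0 < t' \<and> t' < r n \<and>
     H (x + s *\<^sub>R e + t *\<^sub>R d) \<bullet> d = K (x + s' *\<^sub>R d + t' *\<^sub>R e) \<bullet> e"
  proof
    fix n
    obtain s t where 1: "0 < s" "s < r n" "0 < t" "t < r n"
      "u (x + r n *\<^sub>R e + r n *\<^sub>R d) - u (x + r n *\<^sub>R e) - u (x + r n *\<^sub>R d) + u x
      = (r n)\<^sup>2 * (H (x + s *\<^sub>R e + t *\<^sub>R d) \<bullet> d)"
      using second_difference_mvt[OF u e r[of n]] by blast
    obtain s' t' where 2: "0 < s'" "s' < r n" "0 < t'" "t' < r n"
      "u (x + r n *\<^sub>R d + r n *\<^sub>R e) - u (x + r n *\<^sub>R d) - u (x + r n *\<^sub>R e) + u x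
      = (r n)\<^sup>2 * (K (x + s' *\<^sub>R d + t' *\<^sub>R e) \<bullet> e)"
      using second_difference_mvt[OF u d r[of n]] by blast
    have "(r n)\<^sup>2 * (H (x + s *\<^sub>R e + t *\<^sub>R d) \<bullet> d) = (r n)\<^sup>2 * (K (x + s' *\<^sub>R d + t' *\<^sub>R e) \<bullet> e)"
      unfolding 1(5)[symmetric] 2(5)[symmetric] by (simp add: algebra_simps)
    then have "H (x + s *\<^sub>R e + t *\<^sub>R d) \<bullet> d = K (x + s' *\<^sub>R d + t' *\<^sub>R e) \<bullet> e"
      using r[of n] by simp
    with 1 2 show "\<exists>s t s' t'. 0 < s \<and> s < r n \<and> 0 < t \<and> t < r n \<and> 0 < s' \<and> s' < r n \<and>
      0 < t' \<and> t' < r n \<and> H (x + s *\<^sub>R e + t *\<^sub>R d) \<bullet> d = K (x + s' *\<^sub>R d + t' *\<^sub>R e) \<bullet> e"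
      by blast
  qed
  then obtain s t s' t' where st: "\<And>n. 0 < s n" "\<And>n. s n < r n" "\<And>n. 0 < t n" "\<And>n. t n < r n"
    "\<And>n. 0 < s' n" "\<And>n. s' n < r n" "\<And>n. 0 < t' n" "\<And>n. t' n < r n"
    and eq: "\<And>n. H (x + s n *\<^sub>R e + t n *\<^sub>R d) \<bullet> d = K (x + s' n *\<^sub>R d + t' n *\<^sub>R e) \<bullet> e"
    by metis
  have isCont: "isCont H x" "isCont K x"
    using C1_grad_continuous_grad[OF e] C1_grad_continuous_grad[OF d]
    by (simp_all add: continuous_on_eq_continuous_at)
  have lim: "q \<longlonglongrightarrow> 0" if "\<And>n. 0 < q n" "\<And>n. q n < r n" for q :: "nat \<Rightarrow> real"
    by (rule tendsto_sandwich[OF _ _ tendsto_const r0]) (use that in \<open>auto intro!: always_eventually less_imp_le\<close>)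
  have "(\<lambda>n. x + s n *\<^sub>R e + t n *\<^sub>R d) \<longlonglongrightarrow> x + 0 *\<^sub>R e + 0 *\<^sub>R d"
    by (intro tendsto_intros lim st)
  then have "(\<lambda>n. H (x + s n *\<^sub>R e + t n *\<^sub>R d) \<bullet> d) \<longlonglongrightarrow> H x \<bullet> d"
    by (intro tendsto_inner tendsto_const isCont_tendsto_compose[OF isCont(1)]) simp
  moreover have "(\<lambda>n. x + s' n *\<^sub>R d + t' n *\<^sub>R e) \<longlonglongrightarrow> x + 0 *\<^sub>R d + 0 *\<^sub>R e"
    by (intro tendsto_intros lim st)
  then have "(\<lambda>n. K (x + s' n *\<^sub>R d + t' n *\<^sub>R e) \<bullet> e) \<longlonglongrightarrow> K x \<bullet> e"
    by (intro tendsto_inner tendsto_const isCont_tendsto_compose[OF isCont(2)]) simp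
  ultimately show ?thesis
    unfolding eq using LIMSEQ_unique by blast
qed

section \<open>Mollification\<close>

text \<open>The exceptional set is open and negligible, hence empty. This upgrades almost-everywhere
  bounds and identities for continuous functions to pointwise ones.\<close>

lemma AE_closed_imp_all:
  fixes P :: "'a::euclidean_space \<Rightarrow> bool"
  assumes "AE x in lebesgue. P x" "closed {x. P x}"
  shows "P x"
proof -
  have "negligible (- {x. P x})"
    using assms(1) unfolding negligible_iff_null_sets
    by (subst (asm) completion.AE_iff_null_sets) (auto simp: Compl_eq)
  moreover have "open (- {x. P x})"
    using assms(2) by auto
  ultimately have "- {x. P x} = {}"
    using open_not_negligible by blast
  then show ?thesis by auto
qed

lemma continuous_compact_support_integrable:
  fixes f :: "'a::euclidean_space \<Rightarrow> 'b::euclidean_space"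
  assumes "continuous_on UNIV f" "\<And>x. r < norm x \<Longrightarrow> f x = 0"
  shows "integrable lborel f"
proof -
  have "integrable lborel (\<lambda>x. indicator (cball 0 r) x *\<^sub>R f x)"
    by (rule borel_integrable_compact) (use assms in \<open>auto intro: continuous_on_subset\<close>)
  also have "(\<lambda>x. indicator (cball 0 r) x *\<^sub>R f x) = f"
    using assms(2) by (auto simp: fun_eq_iff indicator_def not_le)
  finally show ?thesis .
qed

lemma continuous_compact_support_bounded:
  fixes f :: "'a::euclidean_space \<Rightarrow> 'b::euclidean_space"
  assumes "continuous_on UNIV f" "\<And>x. r < norm x \<Longrightarrow> f x = 0"
  obtains C where "C \<ge> 0" "\<And>x. norm (f x) \<le> C"
proof -
  have "compact (f ` cball 0 r)"
    by (intro compact_continuous_image continuous_on_subset[OF assms(1)]) auto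
  then obtain C where "\<forall>y\<in>f ` cball 0 r. norm y \<le> C"
    using compact_imp_bounded bounded_iff by blast
  then have "norm (f x) \<le> max C 0" for x
    using assms(2)[of x] by (cases "r < norm x") (auto simp: le_max_iff_disj)
  then show ?thesis using that[of "max C 0"] by auto
qed

section \<open>Smooth bumps with compact support\<close>

definition exp_profile :: "nat \<Rightarrow> real \<Rightarrow> real" where
  "exp_profile n t = (if t > 0 then exp (- 1 / t) / t ^ n else 0)"

lemma exp_profile_tendsto_0: "(exp_profile n \<longlongrightarrow> 0) (at 0)"
proof (rule filterlim_split_at)
  have "eventually (\<lambda>t. 0 = exp_profile n t) (at_left 0)"
    by (auto simp: exp_profile_def eventually_at_filter)
  then show "(exp_profile n \<longlongrightarrow> 0) (at_left 0)"
    by (rule Lim_transform_eventually[OF tendsto_const])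
  have "((\<lambda>t::real. inverse t ^ n / exp (inverse t)) \<longlongrightarrow> 0) (at_right 0)"
    by (rule filterlim_compose[OF tendsto_power_div_exp_0 filterlim_inverse_at_top_right])
  moreover have "eventually (\<lambda>t. inverse t ^ n / exp (inverse t) = exp_profile n t) (at_right 0)"
    by (auto simp: exp_profile_def eventually_at_filter exp_minus divide_simps)
  ultimately show "(exp_profile n \<longlongrightarrow> 0) (at_right 0)"
    by (rule Lim_transform_eventually)
qed

text \<open>The index n exists for the sake of this formula: dividing exp (-1/t) by powers of t
  gives a family whose span is closed under differentiation.\<close>

lemma exp_profile_has_derivative:
  "(exp_profile n has_real_derivative - real n * exp_profile (n + 1) t + exp_profile (n + 2) t) (at t)"
proof -
  consider "t > 0" | "t < 0" | "t = 0" by linarith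
  then show ?thesis
  proof cases
    case 1
    have "((\<lambda>t. exp (- 1 / t) / t ^ n) has_real_derivative
        - real n * exp_profile (n + 1) t + exp_profile (n + 2) t) (at t)"
      using 1 by (auto intro!: derivative_eq_intros simp: exp_profile_def)
        (cases n; simp add: field_simps power2_eq_square)
    then show ?thesis
      by (rule DERIV_cong_ev[THEN iffD1, OF refl _ refl, rotated])
        (use 1 eventually_nhds_in_open[of "{0<..}" t] in \<open>auto elim!: eventually_mono simp: exp_profile_def\<close>)
  next
    case 2
    have "((\<lambda>t. 0) has_real_derivative - real n * exp_profile (n + 1) t + exp_profile (n + 2) t) (at t)"
      using 2 by (simp add: exp_profile_def)
    then show ?thesis
      by (rule DERIV_cong_ev[THEN iffD1, OF refl _ refl, rotated])
        (use 2 eventually_nhds_in_open[of "{..<0}" t] in \<open>auto elim!: eventually_mono simp: exp_profile_def\<close>)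
  next
    case 3
    \<comment> \<open>At 0 the difference quotient of the profile is again a profile, with index n +
      1, and every profile tends to 0 there.\<close>
    have "eventually (\<lambda>h. exp_profile (n + 1) h = (exp_profile n (0 + h) - exp_profile n 0) / h) (at 0)"
      by (auto simp: exp_profile_def eventually_at_filter)
    then have "((\<lambda>h. (exp_profile n (0 + h) - exp_profile n 0) / h) \<longlongrightarrow> 0) (at 0)"
      by (rule Lim_transform_eventually[OF exp_profile_tendsto_0])
    then show ?thesis
      using 3 by (simp add: DERIV_def exp_profile_def)
  qed
qed

text \<open>An algebra of functions that contains the bump \<open>exp (- 1 / (r - |x|\<^sup>2))\<close> and is
  closed under directional derivatives, hence consists of smooth functions.\<close>

inductive bump_algebra :: "real \<Rightarrow> ('a::euclidean_space \<Rightarrow> real) \<Rightarrow> bool" for r where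
  const: "bump_algebra r (\<lambda>x. c)"
| inner: "bump_algebra r (\<lambda>x. x \<bullet> v)"
| bump: "bump_algebra r (\<lambda>x. exp_profile n (r - x \<bullet> x))"
| add: "bump_algebra r f \<Longrightarrow> bump_algebra r g \<Longrightarrow> bump_algebra r (\<lambda>x. f x + g x)"
| mult: "bump_algebra r f \<Longrightarrow> bump_algebra r g \<Longrightarrow> bump_algebra r (\<lambda>x. f x * g x)"

lemma bump_algebra_derivative:
  assumes "bump_algebra r f"
  shows "\<exists>D. (\<forall>x. (f has_derivative D x) (at x)) \<and> (\<forall>v. bump_algebra r (\<lambda>x. D x v))"
  using assms
proof induction
  case (const c)
  show ?case
    by (rule exI[where x = "\<lambda>x v. 0"]) (auto intro: bump_algebra.intros)
next
  case (inner w)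
  show ?case
    by (rule exI[where x = "\<lambda>x v. v \<bullet> w"]) (auto intro!: bump_algebra.intros derivative_eq_intros)
next
  case (bump n)
  have "((\<lambda>x::'a. exp_profile n (r - x \<bullet> x)) has_derivative
     (\<lambda>v. (- real n * exp_profile (n + 1) (r - x \<bullet> x) + exp_profile (n + 2) (r - x \<bullet> x))
        * (- 2 * (x \<bullet> v)))) (at x)" for x
  proof -
    have "((\<lambda>x::'a. r - x \<bullet> x) has_derivative (\<lambda>v. - 2 * (x \<bullet> v))) (at x)"
      by (auto intro!: derivative_eq_intros simp: fun_eq_iff inner_commute)
    from has_derivative_compose[OF this
        exp_profile_has_derivative[of n, unfolded has_field_derivative_def]]
    show ?thesis .
  qed
  moreover have "bump_algebra r (\<lambda>x::'a. (- real n * exp_profile (n + 1) (r - x \<bullet> x)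
      + exp_profile (n + 2) (r - x \<bullet> x)) * (- 2 * (x \<bullet> v)))" for v
    by (intro bump_algebra.intros)
  ultimately show ?case
    by (intro exI conjI allI)
next
  case (add f g)
  then obtain D E where "\<forall>x. (f has_derivative D x) (at x)" "\<forall>v. bump_algebra r (\<lambda>x. D x v)"
    "\<forall>x. (g has_derivative E x) (at x)" "\<forall>v. bump_algebra r (\<lambda>x. E x v)"
    by blast
  then show ?case
    by (intro exI[where x = "\<lambda>x v. D x v + E x v"])
      (auto intro!: bump_algebra.add derivative_intros)
next
  case (mult f g)
  then obtain D E where "\<forall>x. (f has_derivative D x) (at x)" "\<forall>v. bump_algebra r (\<lambda>x. D x v)"
    "\<forall>x. (g has_derivative E x) (at x)" "\<forall>v. bump_algebra r (\<lambda>x. E x v)"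
    by blast
  with mult.hyps show ?case
    by (intro exI[where x = "\<lambda>x v. f x * E x v + D x v * g x"])
      (auto intro!: bump_algebra.add bump_algebra.mult derivative_intros)
qed

lemma bump_algebra_smooth: "bump_algebra r f \<Longrightarrow> Ck_on k UNIV f"
proof (induction k arbitrary: f)
  case 0
  then show ?case
    using bump_algebra_derivative[OF 0]
    by (auto intro: has_derivative_continuous_on has_derivative_at_withinI)
next
  case (Suc k)
  obtain D where D: "\<And>x. (f has_derivative D x) (at x)" "\<And>v. bump_algebra r (\<lambda>x. D x v)"
    using bump_algebra_derivative[OF Suc.prems] by blast
  have "frechet_derivative f (at x) = D x" for x
    using frechet_derivative_at[OF D(1)] by simp
  with D Suc.IH show ?case
    by (auto simp: differentiable_def)
qed

lemma exists_mollifier: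
  assumes "r > 0"
  obtains \<rho> :: "'a::euclidean_space \<Rightarrow> real" where "\<And>k. Ck_on k UNIV \<rho>" "\<And>x. \<rho> x \<ge> 0"
    "\<And>x. r < norm x \<Longrightarrow> \<rho> x = 0" "(LINT x|lborel. \<rho> x) = 1"
proof -
  define \<beta> :: "'a \<Rightarrow> real" where "\<beta> x = exp_profile 0 (r\<^sup>2 - x \<bullet> x)" for x
  have cont: "continuous_on UNIV \<beta>"
    using bump_algebra_smooth[OF bump_algebra.bump[of "r\<^sup>2" 0], of 0] by (simp add: \<beta>_def[abs_def])
  have nn: "\<beta> x \<ge> 0" for x by (simp add: \<beta>_def exp_profile_def)
  have z: "\<beta> x = 0" if "r < norm x" for x
  proof -
    have "r\<^sup>2 < (norm x)\<^sup>2" using that assms by (intro power_strict_mono) auto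
    then show ?thesis by (simp add: \<beta>_def exp_profile_def power2_norm_eq_inner)
  qed
  define c where "c = (LINT x|lborel. \<beta> x)"
  have int: "integrable lborel \<beta>"
    by (rule continuous_compact_support_integrable[OF cont z])
  \<comment> \<open>A nonnegative continuous function with integral 0 vanishes identically, but the
    bump is positive at the origin.\<close>
  have "c \<noteq> 0"
  proof
    assume "c = 0"
    then have "AE x in lborel. \<beta> x = 0"
      using int nn unfolding c_def by (subst (asm) integral_nonneg_eq_0_iff_AE) auto
    then have "\<beta> 0 = 0"
      by (intro AE_closed_imp_all[where P = "\<lambda>x. \<beta> x = 0"])
        (auto intro: AE_completion closed_Collect_eq cont)
    then show False using assms by (simp add: \<beta>_def exp_profile_def)
  qed
  moreover have "c \<ge> 0" unfolding c_def using nn by simp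
  ultimately have "c > 0" by simp
  show ?thesis
  proof (rule that[of "\<lambda>x. 1 / c * \<beta> x"])
    show "Ck_on k UNIV (\<lambda>x. 1 / c * \<beta> x)" for k
      unfolding \<beta>_def
      by (rule bump_algebra_smooth[where r = "r\<^sup>2"]) (rule bump_algebra.intros)+
  qed (use \<open>c > 0\<close> nn z in \<open>simp_all add: c_def\<close>)
qed

section \<open>Convolution\<close>

lemma integral_lborel_reflect:
  fixes f :: "'a::euclidean_space \<Rightarrow> 'b::euclidean_space"
  assumes "f \<in> borel_measurable borel"
  shows "(LINT t|lborel. f (x - t)) = (LINT t|lborel. f t)"
proof -
  have "(lborel :: 'a measure) = distr lborel borel (\<lambda>t. x - t)"
    using lborel_affine[of "-1" x] by (simp add: density_1)
  then have "(LINT t|lborel. f t) = (LINT t|distr lborel borel (\<lambda>t. x - t). f t)"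
    by simp
  also have "\<dots> = (LINT t|lborel. f (x - t))"
    using assms by (intro integral_distr) auto
  finally show ?thesis by simp
qed

text \<open>The first factor is scalar and the second may be vector valued, so that gradients can be
  inserted. Derivatives always fall on the second factor.\<close>

definition convolve :: "('a::euclidean_space \<Rightarrow> real) \<Rightarrow> ('a \<Rightarrow> 'b::euclidean_space) \<Rightarrow> 'a \<Rightarrow> 'b" where
  "convolve g K x = (LINT t|lborel. g t *\<^sub>R K (x - t))"

text \<open>The box contains the support of g and does not depend on x, so the library's rule for
  differentiating parameter integrals over boxes becomes applicable.\<close>

lemma convolve_eq_cbox_integral:
  fixes K :: "'a::euclidean_space \<Rightarrow> 'b::euclidean_space"
  assumes g: "continuous_on UNIV g" "\<And>x. r < norm x \<Longrightarrow> g x = 0" and K: "continuous_on UNIV K"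
  shows "convolve g K x
    = integral (cbox (- (r *\<^sub>R One)) (r *\<^sub>R One)) (\<lambda>t. g t *\<^sub>R K (x - t))"
proof -
  let ?Q = "cbox (- (r *\<^sub>R One)) (r *\<^sub>R One) :: 'a set"
  have Q: "g t = 0" if "t \<notin> ?Q" for t
  proof (rule g(2), rule ccontr)
    assume "\<not> r < norm t"
    then have "\<bar>t \<bullet> b\<bar> \<le> r" if "b \<in> Basis" for b
      using Basis_le_norm[OF that, of t] by linarith
    then have "t \<in> ?Q" by (auto simp: mem_box abs_le_iff minus_le_iff)
    with that show False by simp
  qed
  have cont: "continuous_on A (\<lambda>t. g t *\<^sub>R K (x - t))" for A
    by (intro continuous_intros continuous_on_compose2[OF K] continuous_on_subset[OF g(1)]) auto
  have "set_integrable lborel ?Q (\<lambda>t. g t *\<^sub>R K (x - t))"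
    unfolding set_integrable_def by (intro borel_integrable_compact cont) auto
  then have "integral ?Q (\<lambda>t. g t *\<^sub>R K (x - t)) = (LINT t:?Q|lborel. g t *\<^sub>R K (x - t))"
    by (simp add: set_borel_integral_eq_integral)
  also have "\<dots> = convolve g K x"
    unfolding convolve_def set_lebesgue_integral_def
    using Q by (intro Bochner_Integration.integral_cong refl) (auto simp: indicator_def)
  finally show ?thesis by simp
qed

lemma convolve_C1_grad:
  assumes g: "continuous_on UNIV g" "\<And>x. r < norm x \<Longrightarrow> g x = 0" and K: "C1_grad K DK"
  shows "C1_grad (convolve g K) (convolve g DK)"
proof -
  note contK = C1_grad_continuous[OF K] and contDK = C1_grad_continuous_grad[OF K]
  let ?a = "- (r *\<^sub>R One) :: 'a" and ?b = "r *\<^sub>R One :: 'a"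
  \<comment> \<open>\<open>leibniz_rule\<close> expects the derivative as a bounded linear map, so
    the gradient is replaced by the functional that takes inner products with it.\<close>
  define fx where "fx x t = g t *\<^sub>R blinfun_inner_right (DK (x - t))" for x t
  have eqK: "convolve g K = (\<lambda>x. integral (cbox ?a ?b) (\<lambda>t. g t *\<^sub>R K (x - t)))"
    by (rule ext) (rule convolve_eq_cbox_integral[OF g contK])
  have eqD: "convolve g DK = (\<lambda>x. integral (cbox ?a ?b) (\<lambda>t. g t *\<^sub>R DK (x - t)))"
    by (rule ext) (rule convolve_eq_cbox_integral[OF g contDK])
  have contfx: "continuous_on S (\<lambda>(x, t). fx x t)" for S
    unfolding fx_def split_beta
    by (intro continuous_intros bounded_linear.continuous_on[OF bounded_linear_blinfun_inner_right]
        continuous_on_compose2[OF contDK] continuous_on_compose2[OF g(1)]) auto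
  have contD: "continuous_on S (\<lambda>(x, t). g t *\<^sub>R DK (x - t))" for S
    unfolding split_beta
    by (intro continuous_intros continuous_on_compose2[OF contDK] continuous_on_compose2[OF g(1)]) auto
  have contD1: "continuous_on S (\<lambda>t. g t *\<^sub>R DK (x - t))" for S x
    by (intro continuous_intros continuous_on_compose2[OF contDK] continuous_on_compose2[OF g(1)]) auto
  have contfx1: "continuous_on S (fx x)" for S x
    unfolding fx_def
    by (intro continuous_intros bounded_linear.continuous_on[OF bounded_linear_blinfun_inner_right]
        continuous_on_compose2[OF contDK] continuous_on_compose2[OF g(1)]) auto
  show ?thesis
    unfolding C1_grad_def
  proof (intro conjI allI)
    show "continuous_on UNIV (convolve g DK)"
      unfolding eqD by (rule integral_continuous_on_param) (rule contD)
    fix x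
    have "((\<lambda>x. integral (cbox ?a ?b) (\<lambda>t. g t *\<^sub>R K (x - t))) has_derivative
        blinfun_apply (integral (cbox ?a ?b) (fx x))) (at x within UNIV)"
    proof (rule leibniz_rule)
      fix x t :: 'a
      have "((\<lambda>x. x - t) has_derivative (\<lambda>h. h)) (at x)"
        by (auto intro!: derivative_eq_intros)
      from has_derivative_compose[OF this C1_gradD[OF K, of "x - t"]]
      show "((\<lambda>x. g t *\<^sub>R K (x - t)) has_derivative blinfun_apply (fx x t)) (at x within UNIV)"
        unfolding fx_def by (auto intro!: derivative_eq_intros simp: scaleR_blinfun.rep_eq)
    next
      show "(\<lambda>t. g t *\<^sub>R K (x - t)) integrable_on cbox ?a ?b" for x
        by (intro integrable_continuous continuous_intros continuous_on_compose2[OF contK]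
            continuous_on_compose2[OF g(1)]) auto
    qed (use contfx in auto)
    moreover have "blinfun_apply (integral (cbox ?a ?b) (fx x)) = (\<lambda>h. convolve g DK x \<bullet> h)"
    proof
      fix h
      have "blinfun_apply (integral (cbox ?a ?b) (fx x)) h
          = integral (cbox ?a ?b) (\<lambda>t. blinfun_apply (fx x t) h)"
        by (rule blinfun_apply_integral) (intro integrable_continuous contfx1)
      also have "\<dots> = integral (cbox ?a ?b) (\<lambda>t. (g t *\<^sub>R DK (x - t)) \<bullet> h)"
        by (simp add: fx_def scaleR_blinfun.rep_eq)
      also have "\<dots> = integral (cbox ?a ?b) (\<lambda>t. g t *\<^sub>R DK (x - t)) \<bullet> h"
        using integral_linear[OF integrable_continuous[OF contD1] bounded_linear_inner_left]
        by (simp add: o_def)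
      finally show "blinfun_apply (integral (cbox ?a ?b) (fx x)) h = convolve g DK x \<bullet> h"
        by (simp add: eqD)
    qed
    ultimately show "(convolve g K has_derivative (\<lambda>h. convolve g DK x \<bullet> h)) (at x)"
      unfolding eqK by simp
  qed
qed

text \<open>Both orders are needed: with the kernel second, the convolution inherits its smoothness;
  with the C^1 function second, its gradient is the mollified gradient.\<close>

lemma convolve_commute:
  fixes f g :: "'a::euclidean_space \<Rightarrow> real"
  assumes "continuous_on UNIV f" "continuous_on UNIV g"
  shows "convolve f g = convolve g f"
proof
  fix x
  have "(\<lambda>t. g t * f (x - t)) \<in> borel_measurable borel"
    by (intro borel_measurable_continuous_onI continuous_intros
        continuous_on_compose2[OF assms(1)] assms(2)) auto
  from integral_lborel_reflect[OF this, of x] show "convolve f g x = convolve g f x"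
    by (simp add: convolve_def mult.commute)
qed

text \<open>A directional derivative of the convolution is the convolution with the same directional
  derivative of \<open>\<rho>\<close>, which is smooth again; hence the induction over all smooth
  \<open>\<rho>\<close>.\<close>

lemma convolve_smooth:
  fixes \<rho> :: "'a::euclidean_space \<Rightarrow> real"
  assumes g: "continuous_on UNIV g" "\<And>x. r < norm x \<Longrightarrow> g x = 0" and "\<And>k. Ck_on k UNIV \<rho>"
  shows "Ck_on k UNIV (convolve g \<rho>)"
  using assms(3)
proof (induction k arbitrary: \<rho>)
  case 0
  have "C1_grad \<rho> (grad \<rho>)" using 0 Ck_on_1_C1_grad by blast
  from C1_grad_continuous[OF convolve_C1_grad[OF g this]] show ?case by simp
next
  case (Suc k)
  have C1: "C1_grad \<rho> (grad \<rho>)" using Suc.prems Ck_on_1_C1_grad by blast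
  have D: "C1_grad (convolve g \<rho>) (convolve g (grad \<rho>))"
    by (rule convolve_C1_grad[OF g C1])
  have "frechet_derivative (convolve g \<rho>) (at x) v
      = convolve g (\<lambda>x. frechet_derivative \<rho> (at x) v) x" for x v
  proof -
    have "integrable lborel (\<lambda>t. g t *\<^sub>R grad \<rho> (x - t))"
      by (rule continuous_compact_support_integrable[of _ r])
        (auto intro!: continuous_intros continuous_on_compose2[OF C1_grad_continuous_grad[OF C1]]
          g simp: g(2))
    then have "convolve g (grad \<rho>) x \<bullet> v = (LINT t|lborel. (g t *\<^sub>R grad \<rho> (x - t)) \<bullet> v)"
      unfolding convolve_def by (subst integral_inner_left) auto
    then show ?thesis
      by (simp add: C1_grad_frechet[OF D] C1_grad_frechet[OF C1] convolve_def)
  qed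
  moreover have "Ck_on j UNIV (\<lambda>x. frechet_derivative \<rho> (at x) v)" for j v
    using Suc.prems[of "Suc j"] by simp
  ultimately show ?case
    using Suc.IH differentiableI[OF C1_gradD[OF D]] by auto
qed

text \<open>The convolution is an average of values of h near x. With L = 0 this gives uniform
  bounds, with L = h x it gives convergence.\<close>

lemma convolve_mollifier_close:
  fixes h :: "'a::euclidean_space \<Rightarrow> 'b::euclidean_space"
  assumes \<rho>: "continuous_on UNIV \<rho>" "\<And>x. \<rho> x \<ge> 0" "\<And>x. \<delta> < norm x \<Longrightarrow> \<rho> x = 0"
      "(LINT x|lborel. \<rho> x) = 1"
    and h: "continuous_on UNIV h" "\<And>t. norm t \<le> \<delta> \<Longrightarrow> norm (h (x - t) - L) \<le> \<epsilon>"
  shows "norm (convolve \<rho> h x - L) \<le> \<epsilon>"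
proof -
  have i1: "integrable lborel \<rho>"
    by (rule continuous_compact_support_integrable[OF \<rho>(1,3)])
  have i2: "integrable lborel (\<lambda>t. \<rho> t *\<^sub>R h (x - t))"
    by (rule continuous_compact_support_integrable[of _ \<delta>])
      (auto intro!: continuous_intros \<rho> continuous_on_compose2[OF h(1)] simp: \<rho>(3))
  have "convolve \<rho> h x - L = (LINT t|lborel. \<rho> t *\<^sub>R h (x - t) - \<rho> t *\<^sub>R L)"
    unfolding convolve_def using i1 i2 \<rho>(4) by simp
  also have "norm \<dots> \<le> (LINT t|lborel. norm (\<rho> t *\<^sub>R h (x - t) - \<rho> t *\<^sub>R L))"
    by (rule integral_norm_bound)
  also have "\<dots> \<le> (LINT t|lborel. \<epsilon> * \<rho> t)"
  proof (rule integral_mono)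
    show "integrable lborel (\<lambda>t. norm (\<rho> t *\<^sub>R h (x - t) - \<rho> t *\<^sub>R L))"
      by (intro integrable_norm Bochner_Integration.integrable_diff i2 integrable_scaleR_left i1)
    show "norm (\<rho> t *\<^sub>R h (x - t) - \<rho> t *\<^sub>R L) \<le> \<epsilon> * \<rho> t" for t
    proof (cases "\<delta> < norm t")
      case False
      then show ?thesis
        using mult_left_mono[OF h(2)[of t] \<rho>(2)[of t]] \<rho>(2)[of t]
        by (simp add: scaleR_diff_right[symmetric] mult.commute)
    qed (simp add: \<rho>(3))
  qed (use i1 in auto)
  also have "\<dots> = \<epsilon>" using \<rho>(4) by simp
  finally show ?thesis .
qed

lemma convolve_mollifier_tendsto:
  fixes h :: "'a::euclidean_space \<Rightarrow> 'b::euclidean_space"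
  assumes \<rho>: "\<And>n. continuous_on UNIV (\<rho> n)" "\<And>n x. \<rho> n x \<ge> 0"
      "\<And>n x. inverse (real (Suc n)) < norm x \<Longrightarrow> \<rho> n x = 0" "\<And>n. (LINT x|lborel. \<rho> n x) = 1"
    and h: "continuous_on UNIV h"
  shows "(\<lambda>n. convolve (\<rho> n) h x) \<longlonglongrightarrow> h x"
proof (rule LIMSEQ_I)
  fix e :: real assume "e > 0"
  obtain d where d: "d > 0" "\<And>y. dist y x < d \<Longrightarrow> dist (h y) (h x) < e / 2"
    using h \<open>e > 0\<close> unfolding continuous_on_iff by (metis UNIV_I half_gt_zero)
  obtain N where N: "inverse (real (Suc N)) < d"
    using reals_Archimedean[OF d(1)] by blast
  have "norm (convolve (\<rho> n) h x - h x) < e" if "n \<ge> N" for n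
  proof -
    have "inverse (real (Suc n)) \<le> inverse (real (Suc N))"
      using that by (intro le_imp_inverse_le) auto
    with N have "inverse (real (Suc n)) < d" by linarith
    then have "norm (h (x - t) - h x) \<le> e / 2" if "norm t \<le> inverse (real (Suc n))" for t
      using d(2)[of "x - t"] that by (simp add: dist_norm less_imp_le)
    from convolve_mollifier_close[where \<rho> = "\<rho> n" and \<delta> = "inverse (real (Suc n))",
        OF \<rho>(1)[of n] \<rho>(2)[of n] \<rho>(3)[of n] \<rho>(4)[of n] h this] show ?thesis
      using \<open>e > 0\<close> by linarith
  qed
  then show "\<exists>N. \<forall>n\<ge>N. norm (convolve (\<rho> n) h x - h x) < e" by blast
qed

text \<open>Mollification with kernels of radius 1/(n+1) \<le> 1, which enlarges the support by at
  most 1. The common support and the bound C independent of n are what dominated convergence will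
  ask for.\<close>

lemma C1_compact_support_approximation:
  fixes \<xi> :: "'a::euclidean_space \<Rightarrow> real"
  assumes \<xi>: "C1_grad \<xi> Z" "\<And>x. r < norm x \<Longrightarrow> \<xi> x = 0"
  obtains \<eta> Y C where "\<And>n. test_function (\<eta> n)" "\<And>n. C1_grad (\<eta> n) (Y n)"
    "\<And>n x. r + 1 < norm x \<Longrightarrow> \<eta> n x = 0" "\<And>n x. \<bar>\<eta> n x\<bar> \<le> C" "\<And>n x. norm (Y n x) \<le> C"
    "\<And>x. (\<lambda>n::nat. \<eta> n x) \<longlonglongrightarrow> \<xi> x" "\<And>x. (\<lambda>n. Y n x) \<longlonglongrightarrow> Z x"
proof -
  note c = C1_grad_continuous[OF \<xi>(1)] and cZ = C1_grad_continuous_grad[OF \<xi>(1)]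
  have "\<exists>\<rho>::'a \<Rightarrow> real. (\<forall>k. Ck_on k UNIV \<rho>) \<and> (\<forall>x. \<rho> x \<ge> 0) \<and>
    (\<forall>x. inverse (real (Suc n)) < norm x \<longrightarrow> \<rho> x = 0) \<and> (LINT x|lborel. \<rho> x) = 1" for n
    using exists_mollifier[of "inverse (real (Suc n))"] by (metis inverse_positive_iff_positive of_nat_0_less_iff zero_less_Suc)
  then obtain \<rho> :: "nat \<Rightarrow> 'a \<Rightarrow> real" where \<rho>: "\<And>n k. Ck_on k UNIV (\<rho> n)" "\<And>n x. \<rho> n x \<ge> 0"
    "\<And>n x. inverse (real (Suc n)) < norm x \<Longrightarrow> \<rho> n x = 0" "\<And>n. (LINT x|lborel. \<rho> n x) = 1"
    by metis
  have \<rho>c: "continuous_on UNIV (\<rho> n)" for n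
    using \<rho>(1)[of 0 n] by simp
  obtain C1 where C1: "\<And>x. norm (\<xi> x) \<le> C1"
    using continuous_compact_support_bounded[OF c \<xi>(2)] by metis
  obtain C2 where C2: "\<And>x. norm (Z x) \<le> C2"
    using continuous_compact_support_bounded[OF cZ, of r] C1_grad_zero_outside[OF \<xi>] by metis
  have zero: "convolve (\<rho> n) \<xi> x = 0" if "r + 1 < norm x" for n x
  proof -
    have "\<rho> n t * \<xi> (x - t) = 0" for t
    proof (cases "inverse (real (Suc n)) < norm t")
      case False
      have "inverse (real (Suc n)) \<le> 1" by (simp add: divide_simps)
      then have "r < norm (x - t)"
        using that False norm_triangle_ineq2[of x t] by linarith
      then show ?thesis by (simp add: \<xi>(2))
    qed (simp add: \<rho>(3))
    then have "(\<lambda>t. \<rho> n t *\<^sub>R \<xi> (x - t)) = (\<lambda>t. 0)"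
      by (simp only: real_scaleR_def)
    then show ?thesis by (simp add: convolve_def)
  qed
  show ?thesis
  proof
    fix n x
    have "{x. convolve (\<rho> n) \<xi> x \<noteq> 0} \<subseteq> cball 0 (r + 1)"
      using zero by (auto simp: not_less[symmetric])
    then have "compact (closure {x. convolve (\<rho> n) \<xi> x \<noteq> 0})"
      by (meson bounded_cball bounded_subset compact_closure)
    moreover have "Ck_on k UNIV (convolve (\<rho> n) \<xi>)" for k
      unfolding convolve_commute[OF \<rho>c c] by (rule convolve_smooth[OF c \<xi>(2) \<rho>(1)])
    ultimately show "test_function (convolve (\<rho> n) \<xi>)"
      unfolding test_function_def by blast
    show "C1_grad (convolve (\<rho> n) \<xi>) (convolve (\<rho> n) Z)"
      by (rule convolve_C1_grad[OF \<rho>c \<rho>(3) \<xi>(1)])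
    show "r + 1 < norm x \<Longrightarrow> convolve (\<rho> n) \<xi> x = 0" by (rule zero)
    show "\<bar>convolve (\<rho> n) \<xi> x\<bar> \<le> max C1 C2"
      using convolve_mollifier_close[where \<rho> = "\<rho> n" and \<delta> = "inverse (real (Suc n))",
          OF \<rho>c[of n] \<rho>(2)[of n] \<rho>(3)[of n] \<rho>(4)[of n] c, where x = x and L = 0 and \<epsilon> = C1] C1
      by (auto simp: le_max_iff_disj)
    show "norm (convolve (\<rho> n) Z x) \<le> max C1 C2"
      using convolve_mollifier_close[where \<rho> = "\<rho> n" and \<delta> = "inverse (real (Suc n))",
          OF \<rho>c[of n] \<rho>(2)[of n] \<rho>(3)[of n] \<rho>(4)[of n] cZ, where x = x and L = 0 and \<epsilon> = C2] C2
      by (auto simp: le_max_iff_disj)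
    show "(\<lambda>n. convolve (\<rho> n) \<xi> x) \<longlonglongrightarrow> \<xi> x" "(\<lambda>n. convolve (\<rho> n) Z x) \<longlonglongrightarrow> Z x"
      by (auto intro: convolve_mollifier_tendsto[OF \<rho>c \<rho>(2) \<rho>(3) \<rho>(4)] c cZ)
  qed
qed

section \<open>Weak identities\<close>

lemma continuous_measurable_lebesgue:
  fixes f :: "'a::euclidean_space \<Rightarrow> 'b::topological_space"
  shows "continuous_on UNIV f \<Longrightarrow> f \<in> borel_measurable lebesgue"
  by (intro measurable_completion) (simp add: borel_measurable_continuous_onI)

lemma integrable_weight_compact_support:
  fixes h :: "'a::euclidean_space \<Rightarrow> real"
  assumes "c \<in> borel_measurable lebesgue" "AE x in lebesgue. \<bar>c x\<bar> \<le> A"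
    and "continuous_on UNIV h" "\<And>x. r < norm x \<Longrightarrow> h x = 0"
  shows "integrable lebesgue (\<lambda>x. c x * h x)"
proof -
  have "integrable lebesgue h"
    using continuous_compact_support_integrable[OF assms(3,4)] assms(3)
    by (simp add: integrable_completion borel_measurable_continuous_onI)
  then have "integrable lebesgue (\<lambda>x. A * norm (h x))" by simp
  then show ?thesis
    by (rule Bochner_Integration.integrable_bound)
      (use assms(1) continuous_measurable_lebesgue[OF assms(3)] assms(2) in
        \<open>auto simp: abs_mult intro!: mult_right_mono elim!: eventually_mono order_trans\<close>)
qed

lemma lebesgue_distr_translation:
  "distr lebesgue lebesgue (\<lambda>x::'a::euclidean_space. x + c) = lebesgue"
  and lebesgue_measurable_translation: "(\<lambda>x::'a. x + c) \<in> lebesgue \<rightarrow>\<^sub>M lebesgue"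
proof -
  have eq: "(\<lambda>x. c + (\<Sum>j\<in>Basis. (1 * (x \<bullet> j)) *\<^sub>R j)) = (\<lambda>x::'a. x + c)"
    by (simp add: euclidean_representation add.commute)
  show "distr lebesgue lebesgue (\<lambda>x::'a. x + c) = lebesgue"
    using lebesgue_affine_euclidean[of "\<lambda>_. 1" c] unfolding eq by (simp add: density_1)
  show "(\<lambda>x::'a. x + c) \<in> lebesgue \<rightarrow>\<^sub>M lebesgue"
    using lebesgue_affine_measurable[of "\<lambda>_. 1" c] unfolding eq by simp
qed

lemma lebesgue_integral_translation:
  fixes f :: "'a::euclidean_space \<Rightarrow> real"
  assumes "f \<in> borel_measurable lebesgue"
  shows "(LINT x|lebesgue. f (x + c)) = (LINT x|lebesgue. f x)"
  using integral_distr[OF lebesgue_measurable_translation assms, of c]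
  by (simp add: lebesgue_distr_translation)

text \<open>Dominated convergence along smooth approximations of \<open>\<xi>\<close>; the
  coefficients need only be bounded almost everywhere. The tests used later involve v, w and their
  quotient and are only C^1.\<close>

lemma weak_identity_C1:
  fixes G :: "'a::euclidean_space \<Rightarrow> 'a"
  assumes weak: "\<And>\<xi>. test_function \<xi> \<Longrightarrow>
      (LINT X|lebesgue. a X * (G X \<bullet> grad \<xi> X)) = (LINT X|lebesgue. F X * \<xi> X)"
    and a: "a \<in> borel_measurable lebesgue" "AE X in lebesgue. \<bar>a X\<bar> \<le> A"
    and F: "F \<in> borel_measurable lebesgue" "AE X in lebesgue. \<bar>F X\<bar> \<le> B"
    and G: "continuous_on UNIV G" "\<And>X. norm (G X) \<le> L"
    and \<xi>: "C1_grad \<xi> Z" "\<And>X. r < norm X \<Longrightarrow> \<xi> X = 0"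
  shows "(LINT X|lebesgue. a X * (G X \<bullet> Z X)) = (LINT X|lebesgue. F X * \<xi> X)"
proof -
  obtain \<eta> Y C where \<eta>: "\<And>n. test_function (\<eta> n)" "\<And>n. C1_grad (\<eta> n) (Y n)"
    "\<And>n x. r + 1 < norm x \<Longrightarrow> \<eta> n x = 0" "\<And>n x. \<bar>\<eta> n x\<bar> \<le> C" "\<And>n x. norm (Y n x) \<le> C"
    "\<And>x. (\<lambda>n::nat. \<eta> n x) \<longlonglongrightarrow> \<xi> x" "\<And>x. (\<lambda>n. Y n x) \<longlonglongrightarrow> Z x"
    by (rule C1_compact_support_approximation[OF \<xi>]) blast+
  let ?I = "\<lambda>x::'a. indicator (cball 0 (r + 1)) x :: real"
  have int: "integrable lebesgue ?I"
    using lmeasurable_cball[of 0 "r + 1"]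
    by (intro integrable_real_indicator) (auto simp: fmeasurable_def)
  have Y0: "Y n x = 0" if "r + 1 < norm x" for n x
    by (rule C1_grad_zero_outside[OF \<eta>(2) \<eta>(3) that])
  have L: "L \<ge> 0" using G(2)[of 0] norm_ge_zero order_trans by blast
  have C: "C \<ge> 0" using \<eta>(5)[of 0 0] norm_ge_zero order_trans by blast
  note [measurable] = a(1) F(1) continuous_measurable_lebesgue[OF G(1)]
    continuous_measurable_lebesgue[OF C1_grad_continuous[OF \<eta>(2)]]
    continuous_measurable_lebesgue[OF C1_grad_continuous_grad[OF \<eta>(2)]]
    continuous_measurable_lebesgue[OF C1_grad_continuous[OF \<xi>(1)]]
    continuous_measurable_lebesgue[OF C1_grad_continuous_grad[OF \<xi>(1)]]
  have "(\<lambda>n. LINT X|lebesgue. a X * (G X \<bullet> Y n X)) \<longlonglongrightarrow> (LINT X|lebesgue. a X * (G X \<bullet> Z X))"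
  proof (rule integral_dominated_convergence[where w = "\<lambda>X. A * (L * C) * ?I X"])
    show "AE X in lebesgue. norm (a X * (G X \<bullet> Y n X)) \<le> A * (L * C) * ?I X" for n
      using a(2)
    proof eventually_elim
      case (elim X)
      show ?case
      proof (cases "r + 1 < norm X")
        case False
        have "\<bar>G X \<bullet> Y n X\<bar> \<le> L * C"
          by (rule order_trans[OF Cauchy_Schwarz_ineq2]) (intro mult_mono G \<eta>(5) L, simp)
        then have "\<bar>a X\<bar> * \<bar>G X \<bullet> Y n X\<bar> \<le> A * (L * C)"
          using elim by (intro mult_mono) auto
        then show ?thesis using False by (simp add: abs_mult)
      qed (simp add: Y0)
    qed
  qed (measurable, auto intro!: AE_I2 tendsto_intros \<eta>(7) simp: int)
  moreover have "(\<lambda>n. LINT X|lebesgue. F X * \<eta> n X) \<longlonglongrightarrow> (LINT X|lebesgue. F X * \<xi> X)"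
  proof (rule integral_dominated_convergence[where w = "\<lambda>X. B * C * ?I X"])
    show "AE X in lebesgue. norm (F X * \<eta> n X) \<le> B * C * ?I X" for n
      using F(2)
    proof eventually_elim
      case (elim X)
      show ?case
      proof (cases "r + 1 < norm X")
        case False
        have "\<bar>F X\<bar> * \<bar>\<eta> n X\<bar> \<le> B * C"
          using elim \<eta>(4) by (intro mult_mono) auto
        then show ?thesis using False by (simp add: abs_mult)
      qed (simp add: \<eta>(3))
    qed
  qed (measurable, auto intro!: AE_I2 tendsto_intros \<eta>(6) simp: int)
  moreover have "(LINT X|lebesgue. a X * (G X \<bullet> Y n X)) = (LINT X|lebesgue. F X * \<eta> n X)" for n
    using weak[OF \<eta>(1)] by (simp add: C1_grad_unique[OF \<eta>(2)])
  ultimately show ?thesis using LIMSEQ_unique by simp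
qed

section \<open>A Liouville theorem\<close>

text \<open>Squaring removes the corner of \<open>max 0 t\<close>: at 0 the difference quotient is
  \<open>max 0 h\<close>. This is the C^1 truncation from which cutoffs are composed.\<close>

lemma squared_positive_part_has_derivative:
  "((\<lambda>t. (max 0 t)\<^sup>2) has_real_derivative 2 * max 0 t) (at t)"
proof -
  consider "t > 0" | "t < 0" | "t = 0" by linarith
  then show ?thesis
  proof cases
    case 1
    have "((\<lambda>t. t\<^sup>2) has_real_derivative 2 * max 0 t) (at t)"
      using 1 by (auto intro!: derivative_eq_intros)
    then show ?thesis
      by (rule DERIV_cong_ev[THEN iffD1, OF refl _ refl, rotated])
        (use 1 eventually_nhds_in_open[of "{0<..}" t] in \<open>auto elim!: eventually_mono\<close>)
  next
    case 2
    have "((\<lambda>t. 0) has_real_derivative 2 * max 0 t) (at t)"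
      using 2 by simp
    then show ?thesis
      by (rule DERIV_cong_ev[THEN iffD1, OF refl _ refl, rotated])
        (use 2 eventually_nhds_in_open[of "{..<0}" t] in \<open>auto elim!: eventually_mono\<close>)
  next
    case 3
    have "((\<lambda>h::real. max 0 h) \<longlongrightarrow> max 0 0) (at 0)"
      by (intro tendsto_intros)
    moreover have "eventually (\<lambda>h::real. max 0 h = ((max 0 (0 + h))\<^sup>2 - (max 0 0)\<^sup>2) / h) (at 0)"
      by (auto simp: eventually_at_filter power2_eq_square max_def)
    ultimately have "((\<lambda>h::real. ((max 0 (0 + h))\<^sup>2 - (max 0 0)\<^sup>2) / h) \<longlongrightarrow> max 0 0) (at 0)"
      by (rule Lim_transform_eventually)
    then show ?thesis
      using 3 by (simp add: DERIV_def)
  qed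
qed

text \<open>The profile h is 1 up to s = 1, 0 from s = 2 on, and has slope at most 4. It is applied
  to s = |X|^2 / R^2, which is differentiable at the origin too. Since |X| \<le> 2 R where the
  gradient can be nonzero, the gradient is at most 4 (2 / R^2) (2 R) = 16 / R.\<close>

lemma exists_cutoff:
  assumes "R > 0"
  obtains \<phi> :: "'a::euclidean_space \<Rightarrow> real" and \<Phi> where "C1_grad \<phi> \<Phi>"
    "\<And>X. 0 \<le> \<phi> X" "\<And>X. \<phi> X \<le> 1" "\<And>X. norm X \<le> R \<Longrightarrow> \<phi> X = 1"
    "\<And>X. norm X \<le> R \<Longrightarrow> \<Phi> X = 0"
    "\<And>X. 2 * R < norm X \<Longrightarrow> \<phi> X = 0" "\<And>X. norm (\<Phi> X) \<le> 16 / R"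
proof -
  define h :: "real \<Rightarrow> real" where "h s = (max 0 (1 - (max 0 (s - 1))\<^sup>2))\<^sup>2" for s
  define h' :: "real \<Rightarrow> real" where
    "h' s = (2 * max 0 (1 - (max 0 (s - 1))\<^sup>2)) * - (2 * max 0 (s - 1))" for s
  have h: "(h has_real_derivative h' s) (at s)" for s
  proof -
    have "((\<lambda>s. s - 1) has_real_derivative 1) (at s)"
      by (auto intro!: derivative_eq_intros)
    from DERIV_chain2[OF squared_positive_part_has_derivative this]
    have "((\<lambda>s. (max 0 (s - 1))\<^sup>2) has_real_derivative 2 * max 0 (s - 1)) (at s)" by simp
    from DERIV_diff[OF DERIV_const[of 1] this]
    have "((\<lambda>s. 1 - (max 0 (s - 1))\<^sup>2) has_real_derivative - (2 * max 0 (s - 1))) (at s)" by simp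
    from DERIV_chain2[OF squared_positive_part_has_derivative this]
    show ?thesis unfolding h_def h'_def .
  qed
  have h'c: "continuous_on UNIV h'"
    unfolding h'_def by (intro continuous_intros)
  have h'0: "h' s = 0" if "s \<le> 1 \<or> 2 \<le> s" for s
  proof (cases "s \<le> 1")
    case False
    then have "1 \<le> (s - 1)\<^sup>2" using that by (simp add: one_le_power)
    then show ?thesis using False by (simp add: h'_def)
  qed (simp add: h'_def)
  have h0: "h s = 0" if "2 \<le> s" for s
  proof -
    have "1 \<le> (s - 1)\<^sup>2" using that by (simp add: one_le_power)
    then show ?thesis using that by (simp add: h_def)
  qed
  have h1: "h s \<le> 1" for s unfolding h_def by (intro power_le_one) auto
  have h'4: "\<bar>h' s\<bar> \<le> 4" for s
  proof (cases "s \<le> 1 \<or> 2 \<le> s")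
    case False
    have "\<bar>h' s\<bar> = (2 * max 0 (1 - (max 0 (s - 1))\<^sup>2)) * (2 * max 0 (s - 1))"
      by (simp add: h'_def abs_mult)
    also have "\<dots> \<le> 2 * 2"
      using False by (intro mult_mono) auto
    finally show ?thesis by simp
  qed (use h'0 in auto)
  define g where "g X = 1 / R\<^sup>2 * (X \<bullet> X)" for X :: 'a
  have g: "C1_grad g (\<lambda>X. (2 / R\<^sup>2) *\<^sub>R X)"
    unfolding C1_grad_def
  proof (intro conjI allI)
    have "((\<lambda>X::'a. X \<bullet> X) has_derivative (\<lambda>h. 2 * (X \<bullet> h))) (at X)" for X
      by (auto intro!: derivative_eq_intros simp: fun_eq_iff inner_commute)
    from has_derivative_mult_right[OF this, of "1 / R\<^sup>2"]
    show "(g has_derivative (\<lambda>h. ((2 / R\<^sup>2) *\<^sub>R X) \<bullet> h)) (at X)" for X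
      by (simp add: g_def[abs_def])
  qed (intro continuous_intros)
  have le1: "g X \<le> 1 \<longleftrightarrow> norm X \<le> R" for X
    using assms by (simp add: g_def divide_le_eq power2_norm_eq_inner[symmetric] abs_le_square_iff[symmetric])
  have ge2: "2 \<le> g X" if "2 * R < norm X" for X
  proof -
    have "2 * R\<^sup>2 \<le> (2 * R)\<^sup>2" by (simp add: power_mult_distrib)
    also have "\<dots> \<le> (norm X)\<^sup>2" using that assms by (intro power_mono) auto
    finally have "2 * R\<^sup>2 \<le> X \<bullet> X" by (simp add: power2_norm_eq_inner)
    then show ?thesis using assms by (simp add: g_def le_divide_eq)
  qed
  show ?thesis
  proof (rule that[of "\<lambda>X. h (g X)" "\<lambda>X. h' (g X) *\<^sub>R ((2 / R\<^sup>2) *\<^sub>R X)"])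
    show "C1_grad (\<lambda>X. h (g X)) (\<lambda>X. h' (g X) *\<^sub>R ((2 / R\<^sup>2) *\<^sub>R X))"
      by (rule C1_grad_compose[OF g h h'c])
    show "norm (h' (g X) *\<^sub>R (2 / R\<^sup>2) *\<^sub>R X) \<le> 16 / R" for X
    proof (cases "2 * R < norm X")
      case False
      have "norm (h' (g X) *\<^sub>R (2 / R\<^sup>2) *\<^sub>R X) = \<bar>h' (g X)\<bar> * (2 / R\<^sup>2 * norm X)"
        by (simp add: abs_mult)
      also have "\<dots> \<le> 4 * (2 / R\<^sup>2 * (2 * R))"
        using False h'4 by (intro mult_mono) auto
      also have "\<dots> = 16 / R" using assms by (simp add: power2_eq_square)
      finally show ?thesis .
    qed (use ge2 h'0 assms in auto)
      show "0 \<le> h (g X)" for X by (simp add: h_def)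
    show "norm X \<le> R \<Longrightarrow> h (g X) = 1" for X using le1[of X] by (simp add: h_def)
  qed (use h0 h1 h'0 le1 ge2 in auto)
qed

text \<open>Along the radii 2^k R the energy increases to a finite limit, so its increments tend to
  0. The decay inequality at these radii leaves E R \<le> K / \<delta> for every \<delta>, and
  \<delta> may be arbitrarily large.\<close>

lemma doubling_energy_zero:
  fixes E :: "real \<Rightarrow> real"
  assumes bd: "\<And>R. R \<ge> Rmin \<Longrightarrow> E R \<le> M" and mono: "\<And>r R. r \<le> R \<Longrightarrow> E r \<le> E R"
    and decay: "\<And>R \<delta>. R \<ge> Rmin \<Longrightarrow> \<delta> > 0 \<Longrightarrow> E R \<le> \<delta> * (E (2 * R) - E R) + K / \<delta>"
    and R: "R \<ge> Rmin" "R > 0" and K: "K \<ge> 0"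
  shows "E R \<le> 0"
proof -
  define a where "a k = E (2 ^ k * R)" for k :: nat
  have R2: "Rmin \<le> 2 ^ k * R" "R \<le> 2 ^ k * R" for k :: nat
  proof -
    show "R \<le> 2 ^ k * R"
      using mult_right_mono[OF one_le_power[of "2::real" k], of R] R by simp
    with R show "Rmin \<le> 2 ^ k * R" by linarith
  qed
  have "incseq a"
    unfolding a_def using R by (intro incseq_SucI mono) auto
  moreover have "\<forall>k. a k \<le> M" unfolding a_def using bd R2 by blast
  ultimately obtain l where l: "a \<longlonglongrightarrow> l"
    using incseq_convergent by blast
  then have "(\<lambda>k. a (Suc k)) \<longlonglongrightarrow> l" by (rule LIMSEQ_Suc)
  with l have diff: "(\<lambda>k. a (Suc k) - a k) \<longlonglongrightarrow> l - l" by (intro tendsto_intros)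
  have le: "E R \<le> K / \<delta>" if "\<delta> > 0" for \<delta>
  proof -
    have "(\<lambda>k. \<delta> * (a (Suc k) - a k) + K / \<delta>) \<longlonglongrightarrow> \<delta> * (l - l) + K / \<delta>"
      by (intro tendsto_intros diff)
    moreover have "E R \<le> \<delta> * (a (Suc k) - a k) + K / \<delta>" for k
      using decay[OF R2(1) that, of k] mono[OF R2(2), of k]
      by (simp add: a_def mult.assoc)
    ultimately have "E R \<le> \<delta> * (l - l) + K / \<delta>"
      by (intro LIMSEQ_le_const) auto
    then show ?thesis by simp
  qed
  show ?thesis
  proof (rule ccontr)
    assume "\<not> E R \<le> 0"
    then have pos: "E R > 0" by simp
    \<comment> \<open>The choice \<delta> = 2 (K + 1) / E R turns the bound into E R times a factor
      smaller than 1.\<close>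
    have "E R \<le> K / (2 * (K + 1) / E R)" using pos K by (intro le) auto
    also have "\<dots> = E R * (K / (2 * (K + 1)))" by simp
    also have "\<dots> < E R * 1" using pos K by (intro mult_strict_left_mono) (auto simp: divide_less_eq)
    finally show False by simp
  qed
qed

text \<open>The quotient \<open>\<sigma> = w / v\<close> solves \<open>div (v\<^sup>2 M \<nabla>\<sigma>) = 0\<close>, where \<open>M\<close> is the matrix of the form \<open>B\<close>.
  Testing with \<open>\<phi>\<^sup>2 \<sigma>\<close> for cutoffs \<open>\<phi>\<close> and using the quadratic growth of the energy of
  \<open>w = v \<sigma>\<close> forces \<open>\<nabla>\<sigma> = 0\<close>.\<close>

lemma positive_solution_Liouville:
  fixes v w q a b :: "'a::euclidean_space \<Rightarrow> real" and n :: "'a \<Rightarrow> 'a"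
  defines "B \<equiv> \<lambda>X Y Z. a X * (Y \<bullet> Z) + b X * ((n X \<bullet> Y) * (n X \<bullet> Z))"
  assumes v: "C1_grad v V" "\<And>X. v X > 0" and w: "C1_grad w W"
    and a: "a \<in> borel_measurable lebesgue" "AE X in lebesgue. \<bar>a X\<bar> \<le> A" "\<And>X. a X > 0"
    and b: "b \<in> borel_measurable lebesgue" "AE X in lebesgue. \<bar>b X\<bar> \<le> A" "\<And>X. b X \<ge> 0"
    and n: "continuous_on UNIV n" "\<And>X. norm (n X) \<le> 1"
    and eqv: "\<And>\<xi> Z r. C1_grad \<xi> Z \<Longrightarrow> (\<And>X. r < norm X \<Longrightarrow> \<xi> X = 0) \<Longrightarrow>
      (LINT X|lebesgue. B X (V X) (Z X)) = (LINT X|lebesgue. q X * v X * \<xi> X)"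
    and eqw: "\<And>\<xi> Z r. C1_grad \<xi> Z \<Longrightarrow> (\<And>X. r < norm X \<Longrightarrow> \<xi> X = 0) \<Longrightarrow>
      (LINT X|lebesgue. B X (W X) (Z X)) = (LINT X|lebesgue. q X * w X * \<xi> X)"
    and growth: "\<And>R. R \<ge> Rmin \<Longrightarrow> (LINT X:ball 0 R|lebesgue. (a X + b X) * (w X)\<^sup>2) \<le> K * R\<^sup>2"
  shows "\<exists>c. \<forall>X. w X = c * v X"
proof -
  define \<sigma> where "\<sigma> X = w X / v X" for X
  define S where "S X = (1 / (v X)\<^sup>2) *\<^sub>R (v X *\<^sub>R W X - w X *\<^sub>R V X)" for X
  define D where "D X = (v X)\<^sup>2 * B X (S X) (S X)" for X
  have vnz: "v X \<noteq> 0" for X using v(2)[of X] by simp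
  have \<sigma>: "C1_grad \<sigma> S"
    unfolding \<sigma>_def[abs_def] S_def[abs_def] by (rule C1_grad_divide[OF w v(1) vnz])
  \<comment> \<open>The difference of the two cross-multiplied gradients is the flux v^2
    \<nabla>\<sigma>, without M; this is how the equation for \<sigma> arises.\<close>
  have vS: "v X *\<^sub>R W X - w X *\<^sub>R V X = (v X)\<^sup>2 *\<^sub>R S X" for X
    using vnz[of X] by (simp add: S_def)
  note cont = C1_grad_continuous[OF v(1)] C1_grad_continuous_grad[OF v(1)]
    C1_grad_continuous[OF w] C1_grad_continuous_grad[OF w]
    C1_grad_continuous[OF \<sigma>] C1_grad_continuous_grad[OF \<sigma>] n(1)
  have B_int: "integrable lebesgue (\<lambda>X. B X (Y X) (Z X))"
    if "continuous_on UNIV Y" "continuous_on UNIV Z" "\<And>X. r < norm X \<Longrightarrow> Z X = 0" for Y Z r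
    unfolding B_def
    by (intro Bochner_Integration.integrable_add integrable_weight_compact_support[OF a(1,2), where r = r]
        integrable_weight_compact_support[OF b(1,2), where r = r] continuous_intros that n)
      (use that(3) in auto)
  have B_nonneg: "B X Y Y \<ge> a X * (norm Y)\<^sup>2" for X Y
    unfolding B_def power2_norm_eq_inner using b(3)[of X] by simp
  have B_upper: "B X Y Y \<le> (a X + b X) * (norm Y)\<^sup>2" for X Y
  proof -
    have "\<bar>n X \<bullet> Y\<bar> \<le> 1 * norm Y"
      by (rule order_trans[OF Cauchy_Schwarz_ineq2]) (intro mult_right_mono n norm_ge_zero)
    then have "(n X \<bullet> Y)\<^sup>2 \<le> (norm Y)\<^sup>2"
      by (simp add: abs_le_square_iff[symmetric])
    then have "b X * (n X \<bullet> Y)\<^sup>2 \<le> b X * (norm Y)\<^sup>2" by (intro mult_left_mono b)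
    then show ?thesis
      by (simp add: B_def power2_norm_eq_inner[symmetric] power2_eq_square[symmetric] distrib_right)
  qed
  have B_bilinear: "B X (Y1 + Y2) Z = B X Y1 Z + B X Y2 Z" "B X (s *\<^sub>R Y) Z = s * B X Y Z"
    "B X Z (Y1 + Y2) = B X Z Y1 + B X Z Y2" "B X Z (s *\<^sub>R Y) = s * B X Z Y"
    "B X (Y1 - Y2) Z = B X Y1 Z - B X Y2 Z" "B X Y Z = B X Z Y" for X Y Y1 Y2 Z s
    by (simp_all add: B_def algebra_simps inner_commute)
  have B_pos: "B X Y Y \<ge> 0" for X Y
    using B_nonneg[where X = X and Y = Y] a(3)[of X] by (meson less_imp_le mult_nonneg_nonneg order_trans zero_le_power2)
  \<comment> \<open>Young's inequality for the form B: expand the nonnegative value of B at \<delta>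
    Y + Z and divide by \<delta>.\<close>
  have B_young: "- 2 * B X Y Z \<le> \<delta> * B X Y Y + B X Z Z / \<delta>" if "\<delta> > 0" for X Y Z \<delta>
  proof -
    have "0 \<le> B X (\<delta> *\<^sub>R Y + Z) (\<delta> *\<^sub>R Y + Z)" by (rule B_pos)
    also have "\<dots> = \<delta> * (\<delta> * B X Y Y + B X Z Z / \<delta> + 2 * B X Y Z)"
      using that by (simp add: B_bilinear(1-4) B_bilinear(6)[where Y = Z and Z = Y] field_simps)
    finally show ?thesis using that by (simp add: zero_le_mult_iff)
  qed
  have D_nonneg: "D X \<ge> 0" for X unfolding D_def by (simp add: B_pos)
  have D_int: "integrable lebesgue (\<lambda>X. s X * D X)"
    if "continuous_on UNIV s" "\<And>X. r < norm X \<Longrightarrow> s X = 0" for s r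
  proof -
    have "integrable lebesgue (\<lambda>X. B X ((v X)\<^sup>2 *\<^sub>R S X) (s X *\<^sub>R S X))"
      by (rule B_int[where r = r]) (use that in \<open>auto intro!: continuous_intros cont\<close>)
    then show ?thesis by (simp add: B_bilinear D_def mult_ac)
  qed
  \<comment> \<open>Weak form of div (v^2 M \<nabla>\<sigma>) = 0: test the equation of w with v
    \<zeta> and that of v with w \<zeta>, then subtract. The right sides are integrals of the same
    function q v w \<zeta>, and by symmetry of B the terms containing \<zeta> cancel on the
    left.\<close>
  have orth: "(LINT X|lebesgue. B X ((v X)\<^sup>2 *\<^sub>R S X) (Z X)) = 0"
    if \<zeta>: "C1_grad \<zeta> Z" "\<And>X. r < norm X \<Longrightarrow> \<zeta> X = 0" for \<zeta> Z r
  proof -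
    note Z0 = C1_grad_zero_outside[OF \<zeta>]
    note \<zeta>c = C1_grad_continuous[OF \<zeta>(1)] C1_grad_continuous_grad[OF \<zeta>(1)]
    have 1: "(LINT X|lebesgue. B X (W X) (v X *\<^sub>R Z X + \<zeta> X *\<^sub>R V X))
        = (LINT X|lebesgue. q X * w X * (v X * \<zeta> X))"
      using \<zeta>(2) by (intro eqw[where r = r] C1_grad_mult v(1) \<zeta>(1)) simp
    have 2: "(LINT X|lebesgue. B X (V X) (w X *\<^sub>R Z X + \<zeta> X *\<^sub>R W X))
        = (LINT X|lebesgue. q X * v X * (w X * \<zeta> X))"
      using \<zeta>(2) by (intro eqv[where r = r] C1_grad_mult w \<zeta>(1)) simp
    have "(LINT X|lebesgue. B X ((v X)\<^sup>2 *\<^sub>R S X) (Z X))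
      = (LINT X|lebesgue. B X (W X) (v X *\<^sub>R Z X + \<zeta> X *\<^sub>R V X)
          - B X (V X) (w X *\<^sub>R Z X + \<zeta> X *\<^sub>R W X))"
      unfolding vS[symmetric]
      by (intro Bochner_Integration.integral_cong refl)
        (simp add: B_bilinear(1-5) B_bilinear(6)[where Y = "W _" and Z = "V _"])
    also have "\<dots> = 0"
    proof (subst Bochner_Integration.integral_diff)
      show "integrable lebesgue (\<lambda>X. B X (W X) (v X *\<^sub>R Z X + \<zeta> X *\<^sub>R V X))"
        "integrable lebesgue (\<lambda>X. B X (V X) (w X *\<^sub>R Z X + \<zeta> X *\<^sub>R W X))"
        by (rule B_int[where r = r]; use \<zeta>(2) Z0 in \<open>auto intro!: continuous_intros cont \<zeta>c\<close>)+
    qed (unfold 1 2, simp add: mult_ac)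
    finally show ?thesis .
  qed
  define E where "E R = (LINT X|lebesgue. indicator (cball 0 R) X * D X)" for R
  \<comment> \<open>On the ball D agrees with \<phi> D for a cutoff \<phi>, and \<phi> D has compact
    support. The maximum with 1 supplies the positive radius that a cutoff requires, as R is
    arbitrary here.\<close>
  have E_int: "integrable lebesgue (\<lambda>X. indicator (cball 0 R) X * D X)" for R
  proof -
    obtain \<phi> \<Phi> where \<phi>: "C1_grad \<phi> \<Phi>" "\<And>X::'a. 0 \<le> \<phi> X" "\<And>X. norm X \<le> max R 1 \<Longrightarrow> \<phi> X = 1"
      "\<And>X. 2 * max R 1 < norm X \<Longrightarrow> \<phi> X = 0"
      by (rule exists_cutoff[of "max R 1"]) auto
    have i: "integrable lebesgue (\<lambda>X. \<phi> X * D X)"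
      by (rule D_int[OF C1_grad_continuous[OF \<phi>(1)] \<phi>(4)])
    have "integrable lebesgue (\<lambda>X. indicator (cball 0 R) X *\<^sub>R (\<phi> X * D X))"
      by (rule integrable_mult_indicator[OF _ i]) auto
    also have "(\<lambda>X. indicator (cball 0 R) X *\<^sub>R (\<phi> X * D X)) = (\<lambda>X. indicator (cball 0 R) X * D X)"
      using \<phi>(3) by (auto simp: fun_eq_iff indicator_def)
    finally show ?thesis .
  qed
  have E_mono: "E r \<le> E R" if "r \<le> R" for r R
    unfolding E_def using that D_nonneg
    by (intro integral_mono E_int) (auto simp: indicator_def)
  \<comment> \<open>2304 = 16^2 * 3^2: the squared cutoff gradient 256 / R^2 times the growth bound
    K (3 R)^2. The absolute value provides the nonnegativity required by
    \<open>doubling_energy_zero\<close>.\<close>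
  define K' where "K' = 2304 * \<bar>K\<bar>"
  define R' where "R' = max Rmin 1"
  \<comment> \<open>Young with \<delta> = 1/2 lets J be absorbed on the left and gives the uniform
    bound. For general \<delta> the gradient term is kept on the annulus only, and \<phi>^2 \<le> 1
    bounds it by E (2 R) - E R.\<close>
  have main: "E R \<le> 4 * K' \<and> (\<forall>\<delta>>0. E R \<le> \<delta> * (E (2 * R) - E R) + K' / \<delta>)" if "R \<ge> R'" for R
  proof -
    have R: "R > 0" "R \<ge> Rmin" using that by (auto simp: R'_def)
    obtain \<phi> \<Phi> where \<phi>: "C1_grad \<phi> \<Phi>" "\<And>X::'a. 0 \<le> \<phi> X" "\<And>X. \<phi> X \<le> 1"
      "\<And>X. norm X \<le> R \<Longrightarrow> \<phi> X = 1" "\<And>X. norm X \<le> R \<Longrightarrow> \<Phi> X = 0"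
      "\<And>X. 2 * R < norm X \<Longrightarrow> \<phi> X = 0" "\<And>X. norm (\<Phi> X) \<le> 16 / R"
      by (rule exists_cutoff[OF R(1)]) blast
    have \<Phi>0: "\<Phi> X = 0" if "2 * R < norm X" for X
      by (rule C1_grad_zero_outside[OF \<phi>(1,6) that])
    note \<phi>c = C1_grad_continuous[OF \<phi>(1)] C1_grad_continuous_grad[OF \<phi>(1)]
    define J where "J = (LINT X|lebesgue. (\<phi> X)\<^sup>2 * D X)"
    define P where "P X = B X (w X *\<^sub>R \<Phi> X) (w X *\<^sub>R \<Phi> X)" for X
    have J_int: "integrable lebesgue (\<lambda>X. (\<phi> X)\<^sup>2 * D X)"
      by (rule D_int[where r = "2 * R"]) (auto intro!: continuous_intros \<phi>c simp: \<phi>(6))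
    have P_int: "integrable lebesgue P"
      unfolding P_def[abs_def]
      by (rule B_int[where r = "2 * R"]) (auto intro!: continuous_intros \<phi>c cont simp: \<Phi>0)
    define C where "C X = B X ((v X)\<^sup>2 *\<^sub>R S X) ((\<sigma> X * \<phi> X) *\<^sub>R \<Phi> X)" for X
    have C_int: "integrable lebesgue C"
      unfolding C_def[abs_def]
      by (rule B_int[where r = "2 * R"]) (auto intro!: continuous_intros \<phi>c cont simp: \<Phi>0)
    have "C1_grad (\<lambda>X. (\<phi> X * \<phi> X) * \<sigma> X)
        (\<lambda>X. (\<phi> X * \<phi> X) *\<^sub>R S X + \<sigma> X *\<^sub>R (\<phi> X *\<^sub>R \<Phi> X + \<phi> X *\<^sub>R \<Phi> X))"
      by (intro C1_grad_mult \<phi>(1) \<sigma>)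
    from orth[OF this, of "2 * R"]
    have "0 = (LINT X|lebesgue. B X ((v X)\<^sup>2 *\<^sub>R S X)
        ((\<phi> X * \<phi> X) *\<^sub>R S X + \<sigma> X *\<^sub>R (\<phi> X *\<^sub>R \<Phi> X + \<phi> X *\<^sub>R \<Phi> X)))"
      using \<phi>(6) by simp
    also have "\<dots> = (LINT X|lebesgue. (\<phi> X)\<^sup>2 * D X + 2 * C X)"
      by (intro Bochner_Integration.integral_cong refl)
        (simp add: B_bilinear(1-4) D_def C_def power2_eq_square algebra_simps)
    also have "\<dots> = J + 2 * (LINT X|lebesgue. C X)"
      using J_int C_int by (simp add: J_def)
    finally have J_eq: "J = (LINT X|lebesgue. - 2 * C X)" by simp
    \<comment> \<open>As v^2 \<sigma> = v w, C is B applied to \<phi> v \<nabla>\<sigma> and w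
      \<nabla>\<phi>, to which Young applies. Where \<nabla>\<phi> vanishes, inside radius R and
      beyond 2 R, C is 0, so the energy term can be restricted to the annulus.\<close>
    have C_le: "- 2 * C X \<le> indicator (cball 0 (2 * R) - cball 0 R) X * (\<delta> * ((\<phi> X)\<^sup>2 * D X)) + P X / \<delta>"
      if "\<delta> > 0" for \<delta> X
    proof (cases "norm X \<le> R \<or> 2 * R < norm X")
      case True
      then have "\<Phi> X = 0" using \<phi>(5) \<Phi>0 by blast
      then show ?thesis using True that
        by (auto simp: C_def B_bilinear(4)[where s = 0, simplified] P_def indicator_def)
    next
      case False
      have "C X = B X ((\<phi> X * v X) *\<^sub>R S X) (w X *\<^sub>R \<Phi> X)"
        using vnz[of X] by (simp add: C_def B_bilinear(2,4) \<sigma>_def power2_eq_square)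
      then show ?thesis
        using B_young[OF that, of X "(\<phi> X * v X) *\<^sub>R S X" "w X *\<^sub>R \<Phi> X"] False
        by (simp add: B_bilinear(2,4) P_def D_def power2_eq_square mult_ac)
    qed
    have E_le_J: "E R \<le> J"
      unfolding E_def J_def
      by (intro integral_mono E_int J_int) (auto simp: indicator_def \<phi>(4) D_nonneg)
    have P_bound: "(LINT X|lebesgue. P X) \<le> K'"
    proof -
      \<comment> \<open>Radius 3 R because the growth hypothesis concerns open balls, while
        \<nabla>\<phi> may live on the closed ball of radius 2 R.\<close>
      have w_int: "set_integrable lebesgue (ball 0 (3 * R)) (\<lambda>X. (a X + b X) * (w X)\<^sup>2)"
      proof -
        obtain \<psi> \<Psi> where \<psi>: "C1_grad \<psi> \<Psi>" "\<And>X::'a. norm X \<le> 3 * R \<Longrightarrow> \<psi> X = 1"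
          "\<And>X. 2 * (3 * R) < norm X \<Longrightarrow> \<psi> X = 0"
          by (rule exists_cutoff[of "3 * R"]) (use R in auto)
        have "integrable lebesgue (\<lambda>X. a X * ((w X)\<^sup>2 * \<psi> X) + b X * ((w X)\<^sup>2 * \<psi> X))"
          by (intro Bochner_Integration.integrable_add
              integrable_weight_compact_support[OF a(1,2), where r = "2 * (3 * R)"]
              integrable_weight_compact_support[OF b(1,2), where r = "2 * (3 * R)"]
              continuous_intros cont C1_grad_continuous[OF \<psi>(1)]) (simp_all add: \<psi>(3))
        then have "integrable lebesgue (\<lambda>X. indicator (ball 0 (3 * R)) X *\<^sub>R
            (a X * ((w X)\<^sup>2 * \<psi> X) + b X * ((w X)\<^sup>2 * \<psi> X)))"
          by (rule integrable_mult_indicator[rotated]) auto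
        also have "(\<lambda>X. indicator (ball 0 (3 * R)) X *\<^sub>R
            (a X * ((w X)\<^sup>2 * \<psi> X) + b X * ((w X)\<^sup>2 * \<psi> X)))
          = (\<lambda>X. indicator (ball 0 (3 * R)) X *\<^sub>R ((a X + b X) * (w X)\<^sup>2))"
          using \<psi>(2) by (auto simp: fun_eq_iff indicator_def algebra_simps)
        finally show ?thesis unfolding set_integrable_def .
      qed
      have "(LINT X|lebesgue. P X)
        \<le> (LINT X|lebesgue. (256 / R\<^sup>2) * (indicator (ball 0 (3 * R)) X *\<^sub>R ((a X + b X) * (w X)\<^sup>2)))"
      proof (intro integral_mono P_int integrable_mult_right w_int[unfolded set_integrable_def])
        fix X
        show "P X \<le> (256 / R\<^sup>2) * (indicator (ball 0 (3 * R)) X *\<^sub>R ((a X + b X) * (w X)\<^sup>2))"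
        proof (cases "2 * R < norm X")
          case True
          then show ?thesis
            using a(3)[of X] b(3)[of X] by (simp add: P_def \<Phi>0 B_def)
        next
          case False
          have "(norm (\<Phi> X))\<^sup>2 \<le> (16 / R)\<^sup>2" by (intro power_mono \<phi>(7) norm_ge_zero)
          then have "(w X)\<^sup>2 * (norm (\<Phi> X))\<^sup>2 \<le> (w X)\<^sup>2 * (256 / R\<^sup>2)"
            by (intro mult_left_mono) (auto simp: power_divide)
          moreover have "0 \<le> a X + b X"
            using a(3)[of X] b(3)[of X] by simp
          ultimately have "(a X + b X) * ((w X)\<^sup>2 * (norm (\<Phi> X))\<^sup>2)
              \<le> (a X + b X) * ((w X)\<^sup>2 * (256 / R\<^sup>2))"
            by (rule mult_left_mono)
          moreover have "P X \<le> (a X + b X) * ((w X)\<^sup>2 * (norm (\<Phi> X))\<^sup>2)"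
            using B_upper[of X "w X *\<^sub>R \<Phi> X"] by (simp add: P_def power_mult_distrib)
          moreover have "X \<in> ball 0 (3 * R)" using False R by simp
          ultimately show ?thesis by (simp add: mult_ac)
        qed
      qed
      also have "\<dots> = (256 / R\<^sup>2) * (LINT X:ball 0 (3 * R)|lebesgue. (a X + b X) * (w X)\<^sup>2)"
        unfolding set_lebesgue_integral_def by simp
      also have "\<dots> \<le> (256 / R\<^sup>2) * (K * (3 * R)\<^sup>2)"
        using R by (intro mult_left_mono growth) auto
      also have "\<dots> \<le> K'" using R by (simp add: K'_def power_mult_distrib)
      finally show ?thesis .
    qed
    have "J \<le> (LINT X|lebesgue. (1 / 2) * ((\<phi> X)\<^sup>2 * D X) + 2 * P X)"
      unfolding J_eq
    proof (intro integral_mono integrable_mult_right Bochner_Integration.integrable_add J_int P_int C_int)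
      show "- 2 * C X \<le> (1 / 2) * ((\<phi> X)\<^sup>2 * D X) + 2 * P X" for X
      proof -
        have "0 \<le> 1 / 2 * ((\<phi> X)\<^sup>2 * D X)" using D_nonneg[of X] by simp
        then have "indicator (cball 0 (2 * R) - cball 0 R) X * (1 / 2 * ((\<phi> X)\<^sup>2 * D X))
            \<le> 1 / 2 * ((\<phi> X)\<^sup>2 * D X)"
          by (simp add: indicator_def)
        then show ?thesis using C_le[of "1 / 2" X] by simp
      qed
    qed
    also have "\<dots> = J / 2 + 2 * (LINT X|lebesgue. P X)"
      using J_int P_int by (simp add: J_def)
    finally have "J \<le> 4 * K'" using P_bound by linarith
    moreover have "J \<le> \<delta> * (E (2 * R) - E R) + K' / \<delta>" if "\<delta> > 0" for \<delta>
    proof -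
      have "J \<le> (LINT X|lebesgue. \<delta> * (indicator (cball 0 (2 * R)) X * D X
          - indicator (cball 0 R) X * D X) + P X / \<delta>)"
        unfolding J_eq
      proof (intro integral_mono integrable_mult_right Bochner_Integration.integrable_add
          Bochner_Integration.integrable_diff E_int integrable_divide P_int C_int)
        fix X
        have "(\<phi> X)\<^sup>2 * D X \<le> 1 * D X"
          using \<phi>(2,3)[of X] by (intro mult_right_mono D_nonneg) (simp add: power_le_one)
        then have "\<delta> * ((\<phi> X)\<^sup>2 * D X) \<le> \<delta> * D X" using that by simp
        with C_le[OF that, of X] R(1)
        show "- 2 * C X \<le> \<delta> * (indicator (cball 0 (2 * R)) X * D X - indicator (cball 0 R) X * D X)
            + P X / \<delta>"
          by (auto simp: indicator_def split: if_splits)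
      qed
      also have "\<dots> = \<delta> * (E (2 * R) - E R) + (LINT X|lebesgue. P X) / \<delta>"
        using E_int P_int by (simp add: E_def)
      also have "\<dots> \<le> \<delta> * (E (2 * R) - E R) + K' / \<delta>"
        using P_bound that by (simp add: divide_right_mono)
      finally show ?thesis .
    qed
    ultimately show ?thesis using E_le_J by (meson order_trans)
  qed
  have S0: "S X = 0" for X
  proof -
    define R where "R = max R' (norm X + 1)"
    have "R \<ge> R'" "R > 0" by (auto simp: R_def R'_def)
    then have "E R \<le> 0"
      using doubling_energy_zero[of R' E "4 * K'" K' R] main E_mono by (auto simp: K'_def)
    moreover have "E R \<ge> 0" unfolding E_def using D_nonneg by (intro integral_nonneg_AE) simp
    ultimately have "AE X in lebesgue. indicator (cball 0 R) X * D X = 0"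
      using E_int[of R] D_nonneg unfolding E_def
      by (subst integral_nonneg_eq_0_iff_AE[symmetric]) auto
    \<comment> \<open>The alternative \<open>R \<le> norm X\<close> makes the condition closed in X,
      so that it passes from almost every point to every point.\<close>
    then have "AE X in lebesgue. R \<le> norm X \<or> S X = 0"
    proof eventually_elim
      case (elim X)
      show ?case
      proof (cases "R \<le> norm X")
        case False
        then have "D X = 0" using elim by simp
        then have "B X (S X) (S X) = 0" using vnz[of X] by (simp add: D_def)
        then have "a X * (norm (S X))\<^sup>2 \<le> 0" using B_nonneg[of X "S X"] by simp
        then show ?thesis using a(3)[of X] by (simp add: mult_le_0_iff)
      qed simp
    qed
    then have "R \<le> norm X \<or> S X = 0"
      by (rule AE_closed_imp_all)
        (intro closed_Collect_disj closed_Collect_le closed_Collect_eq continuous_intros cont)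
    then show ?thesis by (auto simp: R_def)
  qed
  have "(\<sigma> has_derivative (\<lambda>h. 0)) (at X within UNIV)" for X
    using C1_gradD[OF \<sigma>, of X] by (simp add: S0)
  then obtain c where "\<And>X. \<sigma> X = c"
    using has_derivative_zero_constant[of UNIV \<sigma>] by auto
  then have "w X = c * v X" for X
    using vnz[of X] by (metis \<sigma>_def nonzero_divide_eq_eq)
  then show ?thesis by blast
qed

section \<open>The nonlinearity\<close>

text \<open>The mean value theorem does not suffice, since the derivative is bounded only off a null
  set. The gauge integral recovers g from its derivative without any integrability assumption, and
  changing the derivative on a null set does not change that integral.\<close>

lemma Lipschitz_if_AE_deriv_bounded:
  fixes g :: "real \<Rightarrow> real"
  assumes diff: "\<And>s. g differentiable (at s)"
    and bd: "AE s in lebesgue. \<bar>deriv g s\<bar> \<le> C" and C: "C \<ge> 0"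
  shows "\<bar>g s - g t\<bar> \<le> C * \<bar>s - t\<bar>"
proof -
  obtain N where N: "negligible N" "\<And>s. s \<notin> N \<Longrightarrow> \<bar>deriv g s\<bar> \<le> C"
    using bd unfolding completion.AE_iff_null_sets negligible_iff_null_sets by auto
  have le: "\<bar>g s - g t\<bar> \<le> C * (s - t)" if "t \<le> s" for s t
  proof -
    have "(deriv g has_integral (g s - g t)) {t..s}"
    proof (rule fundamental_theorem_of_calculus[OF that])
      fix x
      have "(g has_real_derivative deriv g x) (at x)"
        using diff by (simp add: DERIV_deriv_iff_real_differentiable)
      then show "(g has_vector_derivative deriv g x) (at x within {t..s})"
        by (simp add: has_real_derivative_iff_has_vector_derivative
            has_vector_derivative_at_within)
    qed
    then have "((\<lambda>s. if s \<in> N then 0 else deriv g s) has_integral (g s - g t)) (cbox t s)"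
      unfolding box_real by (rule has_integral_spike[OF N(1), rotated]) auto
    then have "norm (g s - g t) \<le> C * measure lborel (cbox t s)"
      using N(2) C by (intro has_integral_bound) auto
    then show ?thesis using that by simp
  qed
  show ?thesis
    using le[of s t] le[of t s] by (cases "s \<le> t") (auto simp: abs_minus_commute)
qed

section \<open>Null sets and measurability on product spaces\<close>

lemma AE_lebesgue_null_cover:
  assumes "AE x in lebesgue. P x"
  obtains N where "N \<in> sets borel" "AE x in lborel. x \<notin> N" "\<And>x. x \<notin> N \<Longrightarrow> P x"
proof -
  have "AE x in lborel. P x" using assms by (simp add: AE_completion_iff)
  then obtain N where N: "{x \<in> space lborel. \<not> P x} \<subseteq> N" "emeasure lborel N = 0" "N \<in> sets lborel"
    by (rule AE_E)
  then have "AE x in lborel. x \<notin> N" by (intro AE_not_in) (auto simp: null_sets_def)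
  with N show ?thesis by (intro that[of N]) auto
qed

text \<open>Fubini for null sets. The exceptional set is first enlarged to a Borel null set, since
  the product theorems are applied to \<open>lborel\<close> and not to its completion.\<close>

lemma AE_lebesgue_pair:
  fixes P :: "'a::euclidean_space \<times> 'b::euclidean_space \<Rightarrow> bool"
  assumes "AE z in lebesgue. P z"
  shows "AE x in lebesgue. AE s in lebesgue. P (x, s)" "AE s in lebesgue. AE x in lebesgue. P (x, s)"
proof -
  obtain N where N: "N \<in> sets borel" "AE z in lborel. z \<notin> N" "\<And>z. z \<notin> N \<Longrightarrow> P z"
    using AE_lebesgue_null_cover[OF assms] by blast
  have meas: "{z \<in> space (lborel \<Otimes>\<^sub>M lborel). (fst z, snd z) \<notin> N} \<in> sets (lborel \<Otimes>\<^sub>M lborel)"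
    using N(1) unfolding lborel_prod by (simp add: Compl_eq[symmetric])
  have "AE z in (lborel :: 'a measure) \<Otimes>\<^sub>M (lborel :: 'b measure). z \<notin> N"
    using N(2) by (simp only: lborel_prod)
  then have ae: "AE x in lborel. AE s in lborel. (x, s) \<notin> N"
    by (rule lborel_pair.AE_pair)
  then have "AE s in lborel. AE x in lborel. (x, s) \<notin> N"
    using lborel_pair.AE_commute[of "\<lambda>x s. (x, s) \<notin> N", OF meas] by simp
  then show "AE s in lebesgue. AE x in lebesgue. P (x, s)"
    unfolding AE_completion_iff
  proof eventually_elim
    case (elim s)
    then show ?case by eventually_elim (rule N(3))
  qed
  from ae show "AE x in lebesgue. AE s in lebesgue. P (x, s)"
    unfolding AE_completion_iff
  proof eventually_elim
    case (elim x)
    then show ?case by eventually_elim (rule N(3))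
  qed
qed

lemma AE_lebesgue_fst:
  assumes "AE x in lebesgue. P (x::'a::euclidean_space)"
  shows "AE z in (lebesgue :: ('a \<times> 'b::euclidean_space) measure). P (fst z)"
proof -
  obtain N where N: "N \<in> sets borel" "AE z in lborel. z \<notin> N" "\<And>z. z \<notin> N \<Longrightarrow> P z"
    using AE_lebesgue_null_cover[OF assms] by blast
  have "AE z in (lborel :: 'a measure) \<Otimes>\<^sub>M (lborel :: 'b measure). fst z \<notin> N"
  proof (rule lborel_pair.AE_pair_measure)
    show "{z \<in> space ((lborel :: 'a measure) \<Otimes>\<^sub>M (lborel :: 'b measure)). fst z \<notin> N}
        \<in> sets (lborel \<Otimes>\<^sub>M lborel)"
      using N(1) by measurable
  qed (use N(2) in \<open>auto elim!: eventually_mono\<close>)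
  then show ?thesis
    unfolding AE_completion_iff lborel_prod using N(3) by (auto elim!: eventually_mono)
qed

text \<open>A Borel representative composed with the projection is measurable, and it differs from
  the original only on a cylinder over a null set, which is null.\<close>

lemma borel_measurable_lebesgue_fst:
  fixes h :: "'a::euclidean_space \<Rightarrow> real"
  assumes "h \<in> borel_measurable lebesgue"
  shows "(\<lambda>z::'a \<times> 'b::euclidean_space. h (fst z)) \<in> borel_measurable lebesgue"
proof -
  obtain h' where h': "h' \<in> borel_measurable lborel" "AE x in lborel. h x = h' x"
    using completion_ex_borel_measurable_real[OF assms] by blast
  have "(\<lambda>z::'a \<times> 'b. h' (fst z)) \<in> borel_measurable lebesgue"
    using h'(1) by (intro measurable_completion) (simp add: borel_prod[symmetric])
  moreover have "AE z in (lebesgue :: ('a \<times> 'b) measure). h' (fst z) = h (fst z)"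
    by (rule AE_lebesgue_fst) (use h'(2) in \<open>auto simp: AE_completion_iff elim!: eventually_mono\<close>)
  ultimately show ?thesis by (rule borel_measurable_AE)
qed

text \<open>Almost every section \<open>f (\<cdot>, s)\<close> is measurable, so \<open>u\<close> can be discretized with
  values \<open>s\<close> from this conull (hence dense) set.\<close>

lemma Caratheodory_measurable:
  fixes f :: "'a::euclidean_space \<Rightarrow> real \<Rightarrow> real" and u :: "'a \<times> 'b::euclidean_space \<Rightarrow> real"
  assumes f: "(\<lambda>(x, s). f x s) \<in> borel_measurable lebesgue"
    and cont: "\<And>x. continuous_on UNIV (f x)"
    and u: "u \<in> borel_measurable lebesgue"
  shows "(\<lambda>X. f (fst X) (u X)) \<in> borel_measurable lebesgue"
proof -
  obtain g where g: "g \<in> borel_measurable lborel" "AE z in lborel. (case z of (x, s) \<Rightarrow> f x s) = g z"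
    using completion_ex_borel_measurable_real[OF f] by blast
  have "AE s in lebesgue. AE x in lebesgue. f x s = g (x, s)"
    using AE_lebesgue_pair(2)[of "\<lambda>(x, s). f x s = g (x, s)"] g(2)
    by (simp add: AE_completion_iff split_beta)
  then have good: "AE s in lebesgue. (\<lambda>x. f x s) \<in> borel_measurable lebesgue"
  proof eventually_elim
    case (elim s)
    have "(\<lambda>x. g (x, s)) \<in> borel_measurable lebesgue"
      using g(1) by (intro measurable_completion) (simp add: borel_prod[symmetric])
    then show ?case
      by (rule borel_measurable_AE) (use elim in \<open>auto elim!: eventually_mono\<close>)
  qed
  have "\<exists>s. l < s \<and> s < r \<and> (\<lambda>x. f x s) \<in> borel_measurable lebesgue" if "l < r" for l r
  proof (rule ccontr)
    assume *: "\<not> ?thesis"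
    have "negligible {s. (\<lambda>x. f x s) \<notin> borel_measurable lebesgue}"
      using good unfolding completion.AE_iff_null_sets negligible_iff_null_sets by simp
    then have "negligible {l<..<r}"
      by (rule negligible_subset) (use * in auto)
    then show False using open_not_negligible[of "{l<..<r}"] that by simp
  qed
  \<comment> \<open>One good value in every cell of the grid of width 1/(n+1). The cell of u X,
    found by the floor function, yields a value within 1/(n+1) of u X.\<close>
  then have "\<exists>s. real_of_int j / real (Suc n) < s \<and> s < (real_of_int j + 1) / real (Suc n) \<and>
      (\<lambda>x. f x s) \<in> borel_measurable lebesgue" for j n
    by (simp add: divide_strict_right_mono)
  then obtain d where d: "\<And>j n. real_of_int j / real (Suc n) < d j n"
      "\<And>j n. d j n < (real_of_int j + 1) / real (Suc n)"
      "\<And>j n. (\<lambda>x. f x (d j n)) \<in> borel_measurable lebesgue"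
    by metis
  define k where "k n X = \<lfloor>real (Suc n) * u X\<rfloor>" for n X
  have k: "k n \<in> lebesgue \<rightarrow>\<^sub>M count_space UNIV" for n
    unfolding k_def by (intro measurable_compose[OF _ measurable_real_floor] borel_measurable_times u) simp
  have lim: "(\<lambda>n. d (k n X) n) \<longlonglongrightarrow> u X" for X
  proof (rule LIMSEQ_I)
    fix e :: real assume "e > 0"
    obtain N where N: "inverse (real (Suc N)) < e"
      using reals_Archimedean[OF \<open>e > 0\<close>] by blast
    have "norm (d (k n X) n - u X) < e" if "n \<ge> N" for n
    proof -
      have "real_of_int (k n X) \<le> real (Suc n) * u X" "real (Suc n) * u X < real_of_int (k n X) + 1"
        unfolding k_def by linarith+
      then have "real_of_int (k n X) / real (Suc n) \<le> u X"
          "u X < (real_of_int (k n X) + 1) / real (Suc n)"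
        by (simp_all add: field_simps del: of_nat_Suc)
      then have "\<bar>d (k n X) n - u X\<bar> < (real_of_int (k n X) + 1) / real (Suc n) - real_of_int (k n X) / real (Suc n)"
        using d(1,2)[of "k n X" n] by linarith
      also have "\<dots> = inverse (real (Suc n))"
        by (simp add: diff_divide_distrib[symmetric] inverse_eq_divide del: of_nat_Suc)
      also have "\<dots> \<le> inverse (real (Suc N))" using that by (intro le_imp_inverse_le) auto
      finally show ?thesis using N by simp
    qed
    then show "\<exists>N. \<forall>n\<ge>N. norm (d (k n X) n - u X) < e" by blast
  qed
  show ?thesis
  proof (rule borel_measurable_LIMSEQ_real)
    show "(\<lambda>n. f (fst X) (d (k n X) n)) \<longlonglongrightarrow> f (fst X) (u X)" for X
      by (rule isCont_tendsto_compose[OF _ lim])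
        (use cont in \<open>simp add: continuous_on_eq_continuous_at\<close>)
    \<comment> \<open>For fixed n only countably many values d j n occur, and each section of f at
      such a value is measurable.\<close>
    show "(\<lambda>X. f (fst X) (d (k n X) n)) \<in> borel_measurable lebesgue" for n
      by (rule measurable_compose_countable[OF _ k[of n], where f = "\<lambda>j X. f (fst X) (d j n)"])
        (rule borel_measurable_lebesgue_fst[OF d(3)])
  qed
qed

section \<open>Linearization and one-dimensional symmetry\<close>

lemma difference_quotient_sequence:
  assumes "(\<phi> has_real_derivative D) (at 0)"
  shows "(\<lambda>n. (\<phi> (inverse (real (Suc n))) - \<phi> 0) / inverse (real (Suc n))) \<longlonglongrightarrow> D"
proof -
  have "((\<lambda>h. (\<phi> h - \<phi> 0) / h) \<longlongrightarrow> D) (at 0)"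
    using assms by (simp add: DERIV_def)
  moreover have "filterlim (\<lambda>n. inverse (real (Suc n))) (at 0) sequentially"
    by (rule filterlim_atI[OF LIMSEQ_inverse_real_of_nat]) (simp add: always_eventually)
  ultimately show ?thesis by (rule filterlim_compose)
qed

text \<open>The derivative of the field |g|^q g along a curve: with q = p - 2 it is the form |g|^q
  (I + q n n^T), n = \<open>sgn (g t)\<close>, of the linearized operator. As g is nonzero, the norm
  is differentiable and |g|^(q-1) |g| = |g|^q.\<close>

lemma powr_norm_field_derivative:
  fixes g :: "real \<Rightarrow> 'a::real_inner"
  assumes g: "(g has_derivative (\<lambda>h. h *\<^sub>R g')) (at t)" and nz: "g t \<noteq> 0"
  shows "((\<lambda>t. norm (g t) powr q * (g t \<bullet> z)) has_real_derivative
    norm (g t) powr q * (g' \<bullet> z + q * ((sgn (g t) \<bullet> g') * (sgn (g t) \<bullet> z)))) (at t)"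
proof -
  have "((\<lambda>t. norm (g t)) has_derivative (\<lambda>h. (h *\<^sub>R g') \<bullet> sgn (g t))) (at t)"
    by (rule has_derivative_compose[OF g has_derivative_norm[OF nz]])
  then have N: "((\<lambda>t. norm (g t)) has_real_derivative (sgn (g t) \<bullet> g')) (at t)"
    by (simp add: has_field_derivative_def mult_commute_abs inner_commute)
  have z: "((\<lambda>t. g t \<bullet> z) has_real_derivative g' \<bullet> z) (at t)"
    using has_derivative_inner_left[OF g, of z]
    by (simp add: has_field_derivative_def mult_commute_abs)
  have P: "((\<lambda>t. norm (g t) powr q) has_real_derivative
      (q * norm (g t) powr (q - 1)) * (sgn (g t) \<bullet> g')) (at t)"
    by (rule DERIV_chain2[OF has_real_derivative_powr N]) (use nz in simp)
  have "g t \<bullet> z = norm (g t) * (sgn (g t) \<bullet> z)"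
    using nz by (simp add: sgn_div_norm)
  moreover have "norm (g t) powr (q - 1) * norm (g t) = norm (g t) powr q"
    using nz powr_add[of "norm (g t)" "q - 1" 1] by simp
  ultimately have "q * norm (g t) powr (q - 1) * (sgn (g t) \<bullet> g') * (g t \<bullet> z)
      = norm (g t) powr q * (q * ((sgn (g t) \<bullet> g') * (sgn (g t) \<bullet> z)))"
    by (metis (no_types, opaque_lifting) mult.assoc mult.commute)
  then show ?thesis
    by (intro DERIV_cong[OF DERIV_mult[OF P z]]) (simp add: distrib_left mult.commute)
qed

lemma C1_grad_Lipschitz_line:
  assumes u: "C1_grad u G" and L: "\<And>X. norm (G X) \<le> L"
  shows "\<bar>u (X + h *\<^sub>R e) - u X\<bar> \<le> L * norm e * \<bar>h\<bar>"
proof -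
  have "norm (u (X + h *\<^sub>R e) - u (X + 0 *\<^sub>R e)) \<le> L * norm e * norm (h - 0)"
  proof (rule field_differentiable_bound[where S = UNIV])
    show "((\<lambda>t. u (X + t *\<^sub>R e)) has_field_derivative G (X + t *\<^sub>R e) \<bullet> e) (at t within UNIV)" for t
      by (rule C1_grad_line[OF u])
    show "norm (G (X + t *\<^sub>R e) \<bullet> e) \<le> L * norm e" for t
      unfolding real_norm_def
      by (rule order_trans[OF Cauchy_Schwarz_ineq2]) (intro mult_right_mono L norm_ge_zero)
  qed auto
  then show ?thesis by simp
qed

text \<open>Difference quotients of the weak equation in a direction \<open>e\<close> along which the data do not
  vary converge to the linearized equation for \<open>\<partial>\<^sub>e u\<close>.\<close>

lemma linearized_equation:
  fixes u :: "'a::euclidean_space \<times> 'b::euclidean_space \<Rightarrow> real"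
    and f :: "'a \<Rightarrow> real \<Rightarrow> real" and \<alpha> p :: "'a \<Rightarrow> real" and z :: 'b
  defines "e \<equiv> (0, z)"
    and "wt \<equiv> \<lambda>x g. \<alpha> x * norm g powr (p x - 2)"
  assumes u: "C1_grad u G" and H: "\<And>d. C1_grad (\<lambda>X. G X \<bullet> d) (H d)"
    and G: "\<And>X. G X \<noteq> 0" "\<And>X. norm (G X) \<le> L"
    and [measurable]: "\<alpha> \<in> borel_measurable lebesgue" "p \<in> borel_measurable lebesgue"
    and wt_bd: "AE x in lebesgue. \<forall>X. \<bar>wt x (G X)\<bar> \<le> A"
    and p: "\<And>x. p x \<ge> 2" "AE x in lebesgue. p x \<le> P"
    and f: "(\<lambda>(x, s). f x s) \<in> borel_measurable lebesgue" "\<And>x s. f x differentiable (at s)"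
      "AE x in lebesgue. \<forall>s. \<bar>f x s\<bar> \<le> C"
      "AE x in lebesgue. \<forall>s t. \<bar>f x s - f x t\<bar> \<le> C' * \<bar>s - t\<bar>"
    and weak: "\<And>\<xi> Z r. C1_grad \<xi> Z \<Longrightarrow> (\<And>X. r < norm X \<Longrightarrow> \<xi> X = 0) \<Longrightarrow>
      (LINT X|lebesgue. wt (fst X) (G X) * (G X \<bullet> Z X)) = (LINT X|lebesgue. f (fst X) (u X) * \<xi> X)"
    and \<xi>: "C1_grad \<xi> Z" "\<And>X. r < norm X \<Longrightarrow> \<xi> X = 0"
  shows "(LINT X|lebesgue. wt (fst X) (G X) * (H e X \<bullet> Z X) + (wt (fst X) (G X) * (p (fst X) - 2))
      * ((sgn (G X) \<bullet> H e X) * (sgn (G X) \<bullet> Z X)))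
    = (LINT X|lebesgue. deriv (f (fst X)) (u X) * (G X \<bullet> e) * \<xi> X)"
proof -
  define h where "h n = inverse (real (Suc n))" for n
  have h: "0 < h n" "h n \<le> 1" for n by (simp_all add: h_def divide_simps)
  have Gc: "continuous_on UNIV G" by (rule C1_grad_continuous_grad[OF u])
  have uc: "continuous_on UNIV u" by (rule C1_grad_continuous[OF u])
  have Hc: "continuous_on UNIV (H e)" by (rule C1_grad_continuous_grad[OF H])
  note \<xi>c = C1_grad_continuous[OF \<xi>(1)] C1_grad_continuous_grad[OF \<xi>(1)]
  have Z0: "Z X = 0" if "r < norm X" for X by (rule C1_grad_zero_outside[OF \<xi> that])
  have fst_e: "fst e = 0" by (simp add: e_def)
  have Gtc: "continuous_on UNIV (\<lambda>X. G (X + t *\<^sub>R e))" for t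
    by (intro continuous_on_compose2[OF Gc] continuous_intros) auto
  have utc: "continuous_on UNIV (\<lambda>X. u (X + t *\<^sub>R e))" for t
    by (intro continuous_on_compose2[OF uc] continuous_intros) auto
  have sgnc: "continuous_on UNIV (\<lambda>X. sgn (G X))"
    unfolding sgn_div_norm using G(1) by (intro continuous_intros Gc) auto
  note [measurable] = borel_measurable_lebesgue_fst[where 'b = 'b, of \<alpha>]
    borel_measurable_lebesgue_fst[where 'b = 'b, of p]
    continuous_measurable_lebesgue[OF Gc] continuous_measurable_lebesgue[OF uc]
    continuous_measurable_lebesgue[OF Hc] continuous_measurable_lebesgue[OF \<xi>c(1)]
    continuous_measurable_lebesgue[OF \<xi>c(2)] continuous_measurable_lebesgue[OF Gtc]
    continuous_measurable_lebesgue[OF utc] continuous_measurable_lebesgue[OF sgnc]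
  have wt_AE: "AE X in (lebesgue :: ('a \<times> 'b) measure). \<forall>Y. \<bar>wt (fst X) (G Y)\<bar> \<le> A"
    by (rule AE_lebesgue_fst[OF wt_bd])
  have p_AE: "AE X in (lebesgue :: ('a \<times> 'b) measure). p (fst X) \<le> P"
    by (rule AE_lebesgue_fst[OF p(2)])
  have wt_meas [measurable]: "(\<lambda>X. wt (fst X) (G (X + t *\<^sub>R e))) \<in> borel_measurable lebesgue" for t
    unfolding wt_def by measurable
  have wt_meas0 [measurable]: "(\<lambda>X. wt (fst X) (G X)) \<in> borel_measurable lebesgue"
    unfolding wt_def by measurable
  define F where "F t X = f (fst X) (u (X + t *\<^sub>R e))" for t X
  have fc: "continuous_on UNIV (f x)" for x
    using f(2)[of x] by (simp add: continuous_on_eq_continuous_at differentiable_imp_continuous_within)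
  have F_meas [measurable]: "F t \<in> borel_measurable lebesgue" for t
    unfolding F_def by (rule Caratheodory_measurable[OF f(1) fc]) measurable
  have F_AE: "AE X in lebesgue. \<bar>F t X\<bar> \<le> C" for t
    using AE_lebesgue_fst[OF f(3), where 'b = 'b] by (auto simp: F_def elim!: eventually_mono)
  define \<Phi> where "\<Phi> t X = wt (fst X) (G (X + t *\<^sub>R e)) * (G (X + t *\<^sub>R e) \<bullet> Z X)" for t X
  define \<Phi>' where "\<Phi>' t X = wt (fst X) (G (X + t *\<^sub>R e)) * (H e (X + t *\<^sub>R e) \<bullet> Z X
      + (p (fst X) - 2) * ((sgn (G (X + t *\<^sub>R e)) \<bullet> H e (X + t *\<^sub>R e)) * (sgn (G (X + t *\<^sub>R e)) \<bullet> Z X)))"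
    for t X
  have \<Phi>_int: "integrable lebesgue (\<Phi> t)" for t
    unfolding \<Phi>_def
  proof (rule integrable_weight_compact_support[where r = r, OF wt_meas])
    show "AE X in lebesgue. \<bar>wt (fst X) (G (X + t *\<^sub>R e))\<bar> \<le> A"
      using wt_AE by eventually_elim blast
  qed (auto intro!: continuous_intros Gtc \<xi>c simp: Z0)
  have F_int: "integrable lebesgue (\<lambda>X. F t X * \<xi> X)" for t
    by (rule integrable_weight_compact_support[OF F_meas F_AE \<xi>c(1) \<xi>(2)])
  \<comment> \<open>The weak equation is tested with \<open>\<xi>\<close> translated by - t e, and a
    change of variables moves the shift onto u. The data are unaffected because the first component
    of e is 0.\<close>
  have shifted: "(LINT X|lebesgue. \<Phi> t X) = (LINT X|lebesgue. F t X * \<xi> X)" for t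
  proof -
    define \<xi>t where "\<xi>t X = \<xi> (X + - (t *\<^sub>R e))" for X
    define Zt where "Zt X = Z (X + - (t *\<^sub>R e))" for X
    have \<xi>t: "C1_grad \<xi>t Zt"
      unfolding \<xi>t_def Zt_def by (rule C1_grad_translate[OF \<xi>(1)])
    note [measurable] = continuous_measurable_lebesgue[OF C1_grad_continuous[OF \<xi>t]]
      continuous_measurable_lebesgue[OF C1_grad_continuous_grad[OF \<xi>t]]
    have "\<xi>t X = 0" if "r + norm (t *\<^sub>R e) < norm X" for X
      unfolding \<xi>t_def by (rule \<xi>(2)) (use that norm_triangle_ineq2[of X "t *\<^sub>R e"] in simp)
    from weak[OF \<xi>t this]
    have eq: "(LINT X|lebesgue. wt (fst X) (G X) * (G X \<bullet> Zt X))
        = (LINT X|lebesgue. f (fst X) (u X) * \<xi>t X)" .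
    have "(LINT X|lebesgue. \<Phi> t X) = (LINT X|lebesgue. wt (fst X) (G X) * (G X \<bullet> Zt X))"
    proof -
      have "(\<lambda>X. wt (fst X) (G X) * (G X \<bullet> Zt X)) \<in> borel_measurable lebesgue" by measurable
      from lebesgue_integral_translation[OF this, of "t *\<^sub>R e"] show ?thesis
        by (simp add: \<Phi>_def Zt_def fst_e)
    qed
    also have "\<dots> = (LINT X|lebesgue. F 0 X * \<xi>t X)"
      unfolding eq F_def by simp
    also have "\<dots> = (LINT X|lebesgue. F t X * \<xi> X)"
    proof -
      have "(\<lambda>X. F 0 X * \<xi>t X) \<in> borel_measurable lebesgue" by measurable
      from lebesgue_integral_translation[OF this, of "t *\<^sub>R e"] show ?thesis
        by (simp add: F_def \<xi>t_def fst_e)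
    qed
    finally show ?thesis .
  qed
  \<comment> \<open>Symmetry of second derivatives: the derivative of \<nabla>u in direction e is
    the gradient of \<partial>_e u.\<close>
  have G_line: "((\<lambda>t. G (X + t *\<^sub>R e)) has_derivative (\<lambda>s. s *\<^sub>R H e (X + t *\<^sub>R e))) (at t)" for X t
    unfolding has_derivative_componentwise_within[of "\<lambda>t. G (X + t *\<^sub>R e)"]
  proof
    fix b :: "'a \<times> 'b" assume "b \<in> Basis"
    have "((\<lambda>t. G (X + t *\<^sub>R e) \<bullet> b) has_real_derivative H e (X + t *\<^sub>R e) \<bullet> b) (at t)"
      using C1_grad_line[OF H[of b], where e = e] second_derivative_symmetric[OF u H[of e] H[of b]] by simp
    then show "((\<lambda>t. G (X + t *\<^sub>R e) \<bullet> b) has_derivative (\<lambda>s. (s *\<^sub>R H e (X + t *\<^sub>R e)) \<bullet> b)) (at t)"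
      by (simp add: has_field_derivative_def mult_commute_abs)
  qed
  have \<Phi>_deriv: "((\<lambda>t. \<Phi> t X) has_real_derivative \<Phi>' t X) (at t)" for t X
  proof -
    from DERIV_cmult[OF powr_norm_field_derivative[OF G_line G(1)], where c = "\<alpha> (fst X)"]
    show ?thesis by (simp add: \<Phi>_def \<Phi>'_def wt_def mult.assoc)
  qed
  \<comment> \<open>Second derivatives are bounded only on compact sets. The radius allows for a
    point of the support shifted by t e with |t| \<le> 1.\<close>
  obtain Hb where Hb: "\<And>Y. norm Y \<le> r + norm e \<Longrightarrow> norm (H e Y) \<le> Hb" "Hb \<ge> 0"
  proof -
    have "compact (H e ` cball 0 (r + norm e))"
      by (intro compact_continuous_image continuous_on_subset[OF Hc]) auto
    then obtain B where "\<forall>y\<in>H e ` cball 0 (r + norm e). norm y \<le> B"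
      using compact_imp_bounded bounded_iff by blast
    then show ?thesis by (intro that[of "max B 0"]) (auto simp: le_max_iff_disj)
  qed
  obtain Zb where Zb: "Zb \<ge> 0" "\<And>X. norm (Z X) \<le> Zb"
    using continuous_compact_support_bounded[OF \<xi>c(2), of r] Z0 by metis
  obtain \<xi>b where \<xi>b: "\<xi>b \<ge> 0" "\<And>X. norm (\<xi> X) \<le> \<xi>b"
    using continuous_compact_support_bounded[OF \<xi>c(1), of r] \<xi>(2) by metis
  let ?I = "\<lambda>X::'a \<times> 'b. indicator (cball 0 r) X :: real"
  have I_int: "integrable lebesgue ?I"
    using lmeasurable_cball[of 0 r]
    by (intro integrable_real_indicator) (auto simp: fmeasurable_def)
  define M where "M = A * (Hb * Zb + P * (Hb * Zb))"
  \<comment> \<open>Uniformity in t is essential: the quotient is dominated through the mean value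
    theorem, whose intermediate t depends on X.\<close>
  have \<Phi>'_bd: "AE X in lebesgue. \<forall>t. \<bar>t\<bar> \<le> 1 \<longrightarrow> \<bar>\<Phi>' t X\<bar> \<le> M * ?I X"
    using wt_AE p_AE
  proof eventually_elim
    case (elim X)
    show ?case
    proof (intro allI impI)
      fix t :: real assume t: "\<bar>t\<bar> \<le> 1"
      show "\<bar>\<Phi>' t X\<bar> \<le> M * ?I X"
      proof (cases "r < norm X")
        case False
        let ?Y = "X + t *\<^sub>R e"
        have "norm (t *\<^sub>R e) \<le> 1 * norm e" unfolding norm_scaleR by (intro mult_right_mono t) simp
        then have "norm ?Y \<le> r + norm e"
          using False norm_triangle_ineq[of X "t *\<^sub>R e"] by linarith
        note HY = Hb(1)[OF this]
        have 1: "\<bar>H e ?Y \<bullet> Z X\<bar> \<le> Hb * Zb"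
          by (rule order_trans[OF Cauchy_Schwarz_ineq2]) (intro mult_mono HY Zb Hb(2) norm_ge_zero)
        have sg: "norm (sgn (G ?Y)) \<le> 1" by (simp add: norm_sgn)
        have 2: "\<bar>sgn (G ?Y) \<bullet> H e ?Y\<bar> \<le> Hb"
          using order_trans[OF Cauchy_Schwarz_ineq2 mult_mono[OF sg HY]] by simp
        have 3: "\<bar>sgn (G ?Y) \<bullet> Z X\<bar> \<le> Zb"
          using order_trans[OF Cauchy_Schwarz_ineq2 mult_mono[OF sg Zb(2)[of X]]] by simp
        have "\<bar>(p (fst X) - 2) * ((sgn (G ?Y) \<bullet> H e ?Y) * (sgn (G ?Y) \<bullet> Z X))\<bar> \<le> P * (Hb * Zb)"
          unfolding abs_mult using elim(2) p(1)[of "fst X"] 2 3 Hb(2)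
          by (intro mult_mono) auto
        with 1 have "\<bar>H e ?Y \<bullet> Z X + (p (fst X) - 2) * ((sgn (G ?Y) \<bullet> H e ?Y) * (sgn (G ?Y) \<bullet> Z X))\<bar>
            \<le> Hb * Zb + P * (Hb * Zb)" by linarith
        moreover have "\<bar>wt (fst X) (G ?Y)\<bar> \<le> A" using elim(1) by blast
        ultimately have "\<bar>\<Phi>' t X\<bar> \<le> M"
          unfolding \<Phi>'_def M_def abs_mult by (intro mult_mono) auto
        then show ?thesis using False by simp
      qed (simp add: \<Phi>'_def Z0)
    qed
  qed
  have lhs: "(\<lambda>n. LINT X|lebesgue. (\<Phi> (h n) X - \<Phi> 0 X) / h n) \<longlonglongrightarrow> (LINT X|lebesgue. \<Phi>' 0 X)"
  proof (rule integral_dominated_convergence[where w = "\<lambda>X. M * ?I X"])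
    show "\<Phi>' 0 \<in> borel_measurable lebesgue"
      unfolding \<Phi>'_def by simp
    show "(\<lambda>X. (\<Phi> (h n) X - \<Phi> 0 X) / h n) \<in> borel_measurable lebesgue" for n
      using borel_measurable_integrable[OF \<Phi>_int] by measurable
    show "integrable lebesgue (\<lambda>X. M * ?I X)" using I_int by simp
    show "AE X in lebesgue. (\<lambda>n. (\<Phi> (h n) X - \<Phi> 0 X) / h n) \<longlonglongrightarrow> \<Phi>' 0 X"
      unfolding h_def by (intro AE_I2 difference_quotient_sequence \<Phi>_deriv)
    show "AE X in lebesgue. norm ((\<Phi> (h n) X - \<Phi> 0 X) / h n) \<le> M * ?I X" for n
      using \<Phi>'_bd
    proof eventually_elim
      case (elim X)
      obtain t where t: "0 < t" "t < h n" "\<Phi> (h n) X - \<Phi> 0 X = (h n - 0) * \<Phi>' t X"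
        using MVT2[OF h(1)[of n], of "\<lambda>t. \<Phi> t X" "\<lambda>t. \<Phi>' t X"] \<Phi>_deriv by blast
      then have "\<bar>t\<bar> \<le> 1" using h(2)[of n] by linarith
      with elim t h(1)[of n] show ?case by simp
    qed
  qed
  have F_lim: "(\<lambda>n. (F (h n) X - F 0 X) / h n) \<longlonglongrightarrow> deriv (f (fst X)) (u X) * (G X \<bullet> e)" for X
    unfolding h_def
  proof (rule difference_quotient_sequence)
    have "(f (fst X) has_real_derivative deriv (f (fst X)) (u X)) (at (u (X + 0 *\<^sub>R e)))"
      using f(2) by (simp add: DERIV_deriv_iff_real_differentiable)
    from DERIV_chain2[OF this C1_grad_line[OF u]]
    show "((\<lambda>t. F t X) has_real_derivative deriv (f (fst X)) (u X) * (G X \<bullet> e)) (at 0)"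
      by (simp add: F_def)
  qed
  have rhs: "(\<lambda>n. LINT X|lebesgue. (F (h n) X - F 0 X) / h n * \<xi> X)
      \<longlonglongrightarrow> (LINT X|lebesgue. deriv (f (fst X)) (u X) * (G X \<bullet> e) * \<xi> X)"
  proof (rule integral_dominated_convergence[where w = "\<lambda>X. \<bar>C'\<bar> * (L * norm e) * \<xi>b * ?I X"])
    \<comment> \<open>Measurability of this coefficient comes from its being a pointwise limit of
      measurable difference quotients.\<close>
    have "(\<lambda>X. deriv (f (fst X)) (u X) * (G X \<bullet> e)) \<in> borel_measurable lebesgue"
      by (rule borel_measurable_LIMSEQ_real[OF F_lim]) measurable
    then show "(\<lambda>X. deriv (f (fst X)) (u X) * (G X \<bullet> e) * \<xi> X) \<in> borel_measurable lebesgue"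
      by measurable
    show "(\<lambda>X. (F (h n) X - F 0 X) / h n * \<xi> X) \<in> borel_measurable lebesgue" for n
      by measurable
    show "integrable lebesgue (\<lambda>X. \<bar>C'\<bar> * (L * norm e) * \<xi>b * ?I X)" using I_int by simp
    show "AE X in lebesgue. (\<lambda>n. (F (h n) X - F 0 X) / h n * \<xi> X)
        \<longlonglongrightarrow> deriv (f (fst X)) (u X) * (G X \<bullet> e) * \<xi> X"
      by (intro AE_I2 tendsto_intros F_lim)
    have L: "L \<ge> 0" using G(2)[of undefined] norm_ge_zero order_trans by blast
    show "AE X in lebesgue. norm ((F (h n) X - F 0 X) / h n * \<xi> X) \<le> \<bar>C'\<bar> * (L * norm e) * \<xi>b * ?I X" for n
      using AE_lebesgue_fst[OF f(4), where 'b = 'b]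
    proof eventually_elim
      case (elim X)
      show ?case
      proof (cases "r < norm X")
        case False
        have "\<bar>F (h n) X - F 0 X\<bar> \<le> C' * \<bar>u (X + h n *\<^sub>R e) - u X\<bar>"
          using elim by (simp add: F_def)
        also have "\<dots> \<le> \<bar>C'\<bar> * (L * norm e * \<bar>h n\<bar>)"
          by (intro mult_mono C1_grad_Lipschitz_line[OF u G(2)]) auto
        finally have "\<bar>(F (h n) X - F 0 X) / h n\<bar> \<le> \<bar>C'\<bar> * (L * norm e)"
          using h(1)[of n] by (simp add: divide_le_eq mult_ac)
        then have "\<bar>(F (h n) X - F 0 X) / h n\<bar> * \<bar>\<xi> X\<bar> \<le> \<bar>C'\<bar> * (L * norm e) * \<xi>b"
          using \<xi>b(2)[of X] L by (intro mult_mono) auto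
        then show ?thesis using False by (simp add: abs_mult)
      qed (simp add: \<xi>(2))
    qed
  qed
  have eq: "(LINT X|lebesgue. (\<Phi> (h n) X - \<Phi> 0 X) / h n)
      = (LINT X|lebesgue. (F (h n) X - F 0 X) / h n * \<xi> X)" for n
  proof -
    have "(LINT X|lebesgue. (F (h n) X - F 0 X) / h n * \<xi> X)
        = (LINT X|lebesgue. (F (h n) X * \<xi> X - F 0 X * \<xi> X) / h n)"
      by (intro Bochner_Integration.integral_cong refl) (simp add: left_diff_distrib)
    also have "\<dots> = ((LINT X|lebesgue. F (h n) X * \<xi> X) - (LINT X|lebesgue. F 0 X * \<xi> X)) / h n"
      using F_int by simp
    also have "\<dots> = (LINT X|lebesgue. (\<Phi> (h n) X - \<Phi> 0 X) / h n)"
      using \<Phi>_int by (simp add: shifted)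
    finally show ?thesis by (rule sym)
  qed
  have "(LINT X|lebesgue. \<Phi>' 0 X)
      = (LINT X|lebesgue. deriv (f (fst X)) (u X) * (G X \<bullet> e) * \<xi> X)"
    by (rule LIMSEQ_unique[OF lhs[unfolded eq] rhs])
  then show ?thesis by (simp add: \<Phi>'_def distrib_left mult_ac)
qed

text \<open>Moving y orthogonally to c leaves u unchanged, because the y-gradient is always a
  multiple of c. So \<omega> is c normalized, and the profile is u restricted to the line spanned by
  \<omega> in the y-variables.\<close>

lemma frechet_proportional_imp_one_dimensional:
  fixes u :: "'a::euclidean_space \<times> 'b::euclidean_space \<Rightarrow> real"
  assumes u: "C1_grad u G" and G: "\<And>X. snd (G X) = v X *\<^sub>R c" and c: "c \<noteq> 0"
  shows "\<exists>\<omega>\<in>sphere 0 1. \<exists>g. \<forall>x y. u (x, y) = g x (\<omega> \<bullet> y)"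
proof -
  have same: "u (x, y) = u (x, y')" if "sgn c \<bullet> y = sgn c \<bullet> y'" for x y y'
  proof -
    have "c \<bullet> (y' - y) = 0"
      using that c by (simp add: sgn_div_norm inner_diff_right)
    then have "G X \<bullet> (0, y' - y) = 0" for X
      using G[of X] by (simp add: inner_prod_def)
    then have "((\<lambda>t. u ((x, y) + t *\<^sub>R (0, y' - y))) has_real_derivative 0) (at t)" for t
      using C1_grad_line[OF u, of "(x, y)" "(0, y' - y)" t] by simp
    then have "u ((x, y) + 1 *\<^sub>R (0, y' - y)) = u ((x, y) + 0 *\<^sub>R (0, y' - y))"
      by (rule DERIV_isconst_all[rule_format])
    then show ?thesis by simp
  qed
  show ?thesis
  proof (intro bexI[of _ "sgn c"] exI[where x = "\<lambda>x s. u (x, s *\<^sub>R sgn c)"] allI)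
    show "u (x, y) = u (x, (sgn c \<bullet> y) *\<^sub>R sgn c)" for x y
      using c by (intro same) (simp add: power2_norm_eq_inner[symmetric] norm_sgn)
  qed (use c in \<open>simp add: norm_sgn\<close>)
qed

theorem theorem1p2:
  fixes f :: "real^'m \<Rightarrow> real \<Rightarrow> real"
    and \<alpha> p :: "real^'m \<Rightarrow> real"
    and u :: "(real^'m) \<times> (real^'k) \<Rightarrow> real"
    and y1 :: 'k
    and C\<^sub>o :: real
  assumes "structural f \<alpha> p"
    and "Ck_on 1 UNIV u"
    and "Ck_on 2 {X. grad u X \<noteq> 0} u"
    and "Linfty u"
    and "Linfty (grad u)"
    and "W12_loc_vec (grad u)"
    and "weak_solution f \<alpha> p u"
    and "\<forall>X. frechet_derivative u (at X) (0, axis y1 1) > 0"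
    and "C\<^sub>o \<ge> 1"
    and "\<forall>R\<ge>C\<^sub>o. (LINT X:ball 0 R|lebesgue. \<alpha> (fst X) * norm (grad u X) powr p (fst X)) \<le> C\<^sub>o * R\<^sup>2"
  shows "\<exists>\<omega>\<in>sphere (0::real^'k) 1. \<exists>u\<^sub>o :: real^'m \<Rightarrow> real \<Rightarrow> real.
           \<forall>x y. u (x, y) = u\<^sub>o x (\<omega> \<bullet> y)"
proof -
  let ?G = "grad u"
  define H where "H d = grad (\<lambda>X. ?G X \<bullet> d)" for d
  define v where "v X = ?G X \<bullet> (0, axis y1 1)" for X
  have u: "C1_grad u ?G" by (rule Ck_on_1_C1_grad[OF assms(2)])
  have v_pos: "v X > 0" for X
    using assms(8)[rule_format, of X] C1_grad_frechet[OF u] by (simp add: v_def)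
  have Gnz: "?G X \<noteq> 0" for X using v_pos[of X] by (auto simp: v_def)
  have H: "C1_grad (\<lambda>X. ?G X \<bullet> d) (H d)" for d
  proof -
    have "Ck_on (Suc 1) UNIV u"
      using assms(3) Gnz by (simp add: numeral_2_eq_2)
    then have "Ck_on 1 UNIV (\<lambda>X. frechet_derivative u (at X) d)"
      unfolding Ck_on.simps(2)[of 1] by blast
    then show ?thesis
      unfolding H_def C1_grad_frechet[OF u] by (rule Ck_on_1_C1_grad)
  qed
  have Gc: "continuous_on UNIV ?G" by (rule C1_grad_continuous_grad[OF u])
  obtain L where L: "norm (?G X) \<le> L" for X
  proof -
    obtain L where "AE X in lebesgue. norm (?G X) \<le> L"
      using assms(5) unfolding Linfty_def by blast
    then have "norm (?G X) \<le> L" for X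
      by (rule AE_closed_imp_all) (intro closed_Collect_le continuous_intros Gc)
    then show ?thesis by (rule that)
  qed
  have st: "Linfty (\<lambda>(x, s). f x s)" "\<And>x s. f x differentiable (at s)"
    "Linfty (\<lambda>(x, s). deriv (f x) s)" "Linfty \<alpha>" "(INF x. ereal (\<alpha> x)) > 0"
    "Linfty p" "\<And>x. p x \<ge> 2"
    using assms(1) unfolding structural_def by blast+
  have \<alpha>_pos: "\<alpha> x > 0" for x
    using order_less_le_trans[OF st(5) INF_lower[of x UNIV]] by simp
  obtain A where A: "AE x in lebesgue. \<bar>\<alpha> x\<bar> \<le> A" and \<alpha>_meas: "\<alpha> \<in> borel_measurable lebesgue"
    using st(4) unfolding Linfty_def by auto
  obtain P where P: "AE x in lebesgue. \<bar>p x\<bar> \<le> P" and p_meas: "p \<in> borel_measurable lebesgue"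
    using st(6) unfolding Linfty_def by auto
  have P': "AE x in lebesgue. p x \<le> P" using P by (auto elim!: eventually_mono)
  have fc: "continuous_on UNIV (f x)" for x
    using st(2)[of x] by (simp add: continuous_on_eq_continuous_at differentiable_imp_continuous_within)
  \<comment> \<open>The exceptional set of x must not depend on s, as u X will be inserted for s.
    Fubini gives a bound for almost every s, and continuity of f in s extends it to all s.\<close>
  obtain C where C: "AE x in lebesgue. \<forall>s. \<bar>f x s\<bar> \<le> C"
  proof -
    obtain C where "AE z in lebesgue. norm (case z of (x, s) \<Rightarrow> f x s) \<le> C"
      using st(1) unfolding Linfty_def by blast
    from AE_lebesgue_pair(1)[OF this]
    have "AE x in lebesgue. \<forall>s. \<bar>f x s\<bar> \<le> C"
    proof eventually_elim
      case (elim x)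
      then have "\<bar>f x s\<bar> \<le> C" for s
        by (intro AE_closed_imp_all[where P = "\<lambda>s. \<bar>f x s\<bar> \<le> C"])
          (auto intro!: closed_Collect_le continuous_intros fc)
      then show ?case by blast
    qed
    then show ?thesis by (rule that)
  qed
  \<comment> \<open>For almost every x the derivative in s is bounded almost everywhere, which still
    yields a Lipschitz bound. The maximum with 0 makes the constant nonnegative.\<close>
  obtain C' where C': "AE x in lebesgue. \<forall>s t. \<bar>f x s - f x t\<bar> \<le> C' * \<bar>s - t\<bar>"
  proof -
    obtain C where "AE z in lebesgue. norm (case z of (x, s) \<Rightarrow> deriv (f x) s) \<le> C"
      using st(3) unfolding Linfty_def by blast
    from AE_lebesgue_pair(1)[OF this]
    have "AE x in lebesgue. \<forall>s t. \<bar>f x s - f x t\<bar> \<le> max C 0 * \<bar>s - t\<bar>"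
    proof eventually_elim
      case (elim x)
      then have "AE s in lebesgue. \<bar>deriv (f x) s\<bar> \<le> max C 0"
        by eventually_elim auto
      then show ?case
        by (intro allI Lipschitz_if_AE_deriv_bounded st(2)) auto
    qed
    then show ?thesis by (rule that)
  qed
  define wt where "wt x g = \<alpha> x * norm g powr (p x - 2)" for x and g :: "(real^'m) \<times> (real^'k)"
  \<comment> \<open>Taking \<open>max 1 L\<close> as base makes the power monotone in the exponent,
    so one constant serves for exponents p - 2 and p alike.\<close>
  define A' where "A' = A * max 1 L powr P"
  have powr_bd: "norm (?G X) powr q \<le> max 1 L powr P" if "0 \<le> q" "q \<le> P" for X q
  proof -
    have "norm (?G X) powr q \<le> max 1 L powr q"
      using L[of X] that by (intro powr_mono2) auto
    also have "\<dots> \<le> max 1 L powr P" using that by (intro powr_mono) auto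
    finally show ?thesis .
  qed
  have wt_bd: "AE x in lebesgue. \<forall>X. \<bar>wt x (?G X)\<bar> \<le> A'"
    using A P
  proof eventually_elim
    case (elim x)
    then show ?case
      using powr_bd[of "p x - 2"] st(7)[of x]
      by (auto simp: wt_def A'_def abs_mult intro!: mult_mono)
  qed
  define a where "a X = wt (fst X) (?G X)" for X
  define b where "b X = a X * (p (fst X) - 2)" for X
  note [measurable] = borel_measurable_lebesgue_fst[OF \<alpha>_meas, where 'b = "real^'k"]
    borel_measurable_lebesgue_fst[OF p_meas, where 'b = "real^'k"]
    continuous_measurable_lebesgue[OF Gc]
  have a_meas [measurable]: "a \<in> borel_measurable lebesgue"
    unfolding a_def wt_def by measurable
  have b_meas [measurable]: "b \<in> borel_measurable lebesgue"
    unfolding b_def by measurable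
  have a_bd: "AE X in lebesgue. \<bar>a X\<bar> \<le> A'"
    using AE_lebesgue_fst[OF wt_bd, where 'b = "real^'k"]
    unfolding a_def by eventually_elim blast
  have p_bd: "AE X in (lebesgue :: ((real^'m) \<times> (real^'k)) measure). p (fst X) \<le> P"
    by (rule AE_lebesgue_fst[OF P'])
  \<comment> \<open>The Liouville lemma takes one bound for both coefficients. A' P serves for a
    since 1 \<le> p \<le> P, and for b since p - 2 \<le> P, almost everywhere.\<close>
  have ab_bd: "AE X in lebesgue. \<bar>a X\<bar> \<le> A' * P" "AE X in lebesgue. \<bar>b X\<bar> \<le> A' * P"
  proof -
    show "AE X in lebesgue. \<bar>a X\<bar> \<le> A' * P" using a_bd p_bd
    proof eventually_elim
      case (elim X)
      then have "\<bar>a X\<bar> * 1 \<le> A' * P"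
        using st(7)[of "fst X"] by (intro mult_mono) auto
      then show ?case by simp
    qed
    show "AE X in lebesgue. \<bar>b X\<bar> \<le> A' * P" using a_bd p_bd
    proof eventually_elim
      case (elim X)
      then show ?case
        unfolding b_def abs_mult using st(7)[of "fst X"] by (intro mult_mono) auto
    qed
  qed
  have a_pos: "a X > 0" for X
    using \<alpha>_pos Gnz by (simp add: a_def wt_def)
  have b_nonneg: "b X \<ge> 0" for X
    using a_pos[of X] st(7)[of "fst X"] by (simp add: b_def)
  have f_meas: "(\<lambda>(x, s). f x s) \<in> borel_measurable lebesgue"
    using st(1) unfolding Linfty_def by blast
  have F_meas: "(\<lambda>X. f (fst X) (u X)) \<in> borel_measurable lebesgue"
    by (rule Caratheodory_measurable[OF f_meas fc
          continuous_measurable_lebesgue[OF C1_grad_continuous[OF u]]])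
  have F_bd: "AE X in lebesgue. \<bar>f (fst X) (u X)\<bar> \<le> C"
    using AE_lebesgue_fst[OF C, where 'b = "real^'k"] by eventually_elim blast
  have weak: "(LINT X|lebesgue. wt (fst X) (?G X) * (?G X \<bullet> Z X)) = (LINT X|lebesgue. f (fst X) (u X) * \<xi> X)"
    if "C1_grad \<xi> Z" "\<And>X. r < norm X \<Longrightarrow> \<xi> X = 0" for \<xi> Z r
    unfolding a_def[symmetric]
    by (rule weak_identity_C1[OF _ a_meas a_bd F_meas F_bd Gc L that])
      (use assms(7) in \<open>simp add: weak_solution_def a_def wt_def\<close>)
  have linearized: "(LINT X|lebesgue. a X * (H (0, z) X \<bullet> Z X)
      + b X * ((sgn (?G X) \<bullet> H (0, z) X) * (sgn (?G X) \<bullet> Z X)))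
    = (LINT X|lebesgue. deriv (f (fst X)) (u X) * (?G X \<bullet> (0, z)) * \<xi> X)"
    if "C1_grad \<xi> Z" "\<And>X. r < norm X \<Longrightarrow> \<xi> X = 0" for z \<xi> Z r
  proof -
    from linearized_equation[OF u H Gnz L \<alpha>_meas p_meas wt_bd[unfolded wt_def] st(7) P' f_meas st(2)
        C C' weak[unfolded wt_def] that, where z = z]
    show ?thesis unfolding a_def b_def wt_def .
  qed
  have sgnc: "continuous_on UNIV (\<lambda>X. sgn (?G X))"
    unfolding sgn_div_norm using Gnz by (intro continuous_intros Gc) auto
  \<comment> \<open>The constant K: a + b = (p - 1) a \<le> (P - 1) a almost everywhere, and
    Cauchy-Schwarz bounds a |\<partial>_z u|^2 by |z|^2 \<alpha> |\<nabla>u|^p, whose integral over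
    balls is at most \<open>C\<^sub>o * R\<^sup>2\<close>.\<close>
  have "\<exists>c. \<forall>X. ?G X \<bullet> (0, z) = c * v X" for z
  proof (rule positive_solution_Liouville[where n = "\<lambda>X. sgn (?G X)" and a = a and b = b
        and q = "\<lambda>X. deriv (f (fst X)) (u X)" and Rmin = "C\<^sub>o" and K = "(P - 1) * (norm z)\<^sup>2 * C\<^sub>o"])
    show "C1_grad v (H (0, axis y1 1))" unfolding v_def by (rule H)
    show "C1_grad (\<lambda>X. ?G X \<bullet> (0, z)) (H (0, z))" by (rule H)
    show "norm (sgn (?G X)) \<le> 1" for X by (simp add: norm_sgn)
    fix R :: real assume R: "R \<ge> C\<^sub>o"
    define D where "D X = \<alpha> (fst X) * norm (?G X) powr p (fst X)" for X
    have D_nonneg: "D X \<ge> 0" for X using \<alpha>_pos[of "fst X"] by (simp add: D_def)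
    have D_meas [measurable]: "D \<in> borel_measurable lebesgue"
      unfolding D_def by measurable
    have bd: "AE X in lebesgue. \<bar>D X\<bar> \<le> A'"
      using AE_lebesgue_fst[OF A, where 'b = "real^'k"] p_bd
    proof eventually_elim
      case (elim X)
      then show ?case
        using powr_bd[of "p (fst X)" X] st(7)[of "fst X"]
        by (auto simp: D_def A'_def abs_mult intro!: mult_mono)
    qed
    have ball_int: "integrable lebesgue (\<lambda>X. A' * indicat_real (ball 0 R) (X :: (real^'m) \<times> (real^'k)))"
      using lmeasurable_ball[of 0 R]
      by (intro integrable_mult_right integrable_real_indicator) (auto simp: fmeasurable_def)
    have D_int: "set_integrable lebesgue (ball 0 R) D"
      unfolding set_integrable_def
    proof (rule Bochner_Integration.integrable_bound[OF ball_int])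
      show "AE X in lebesgue. norm (indicator (ball 0 R) X *\<^sub>R D X) \<le> norm (A' * indicator (ball 0 R) X)"
        using bd by eventually_elim (auto simp: indicator_def)
    qed (intro borel_measurable_scaleR borel_measurable_indicator D_meas, simp)
    have le: "AE X in lebesgue. (a X + b X) * (?G X \<bullet> (0, z))\<^sup>2 \<le> (P - 1) * (norm z)\<^sup>2 * D X"
      using p_bd
    proof eventually_elim
      case (elim X)
      have "\<bar>?G X \<bullet> (0, z)\<bar> \<le> \<bar>norm (?G X) * norm z\<bar>"
        using Cauchy_Schwarz_ineq2[of "?G X" "(0, z)"] by (simp add: norm_Pair)
      then have "(?G X \<bullet> (0, z))\<^sup>2 \<le> (norm (?G X) * norm z)\<^sup>2"
        by (simp only: abs_le_square_iff)
      then have "a X * (?G X \<bullet> (0, z))\<^sup>2 \<le> a X * ((norm (?G X))\<^sup>2 * (norm z)\<^sup>2)"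
        using a_pos[of X] by (simp add: power_mult_distrib)
      also have "a X * ((norm (?G X))\<^sup>2 * (norm z)\<^sup>2) = D X * (norm z)\<^sup>2"
        using Gnz[of X] powr_add[of "norm (?G X)" "p (fst X) - 2" 2]
        by (simp add: a_def wt_def D_def)
      finally have "a X * (?G X \<bullet> (0, z))\<^sup>2 \<le> D X * (norm z)\<^sup>2" .
      from mult_mono[OF _ this, of "p (fst X) - 1" "P - 1"]
      have "(p (fst X) - 1) * (a X * (?G X \<bullet> (0, z))\<^sup>2) \<le> (P - 1) * (D X * (norm z)\<^sup>2)"
        using elim st(7)[of "fst X"] a_pos[of X] by simp
      then show ?case by (simp add: b_def algebra_simps)
    qed
    have w_int: "set_integrable lebesgue (ball 0 R) (\<lambda>X. (a X + b X) * (?G X \<bullet> (0, z))\<^sup>2)"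
      unfolding set_integrable_def
    proof (rule Bochner_Integration.integrable_bound)
      show "integrable lebesgue (\<lambda>X. (P - 1) * (norm z)\<^sup>2 * (indicator (ball 0 R) X *\<^sub>R D X))"
        using D_int unfolding set_integrable_def by (rule integrable_mult_right)
      show "AE X in lebesgue. norm (indicator (ball 0 R) X *\<^sub>R ((a X + b X) * (?G X \<bullet> (0, z))\<^sup>2))
          \<le> norm ((P - 1) * (norm z)\<^sup>2 * (indicator (ball 0 R) X *\<^sub>R D X))"
        using le
      proof eventually_elim
        case (elim X)
        have "0 \<le> (a X + b X) * (?G X \<bullet> (0, z))\<^sup>2"
          using a_pos[of X] b_nonneg[of X] by simp
        with elim show ?case by (auto simp: indicator_def)
      qed
      have "(\<lambda>X. (a X + b X) * (?G X \<bullet> (0, z))\<^sup>2) \<in> borel_measurable lebesgue" by measurable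
      then show "(\<lambda>X. indicator (ball 0 R) X *\<^sub>R ((a X + b X) * (?G X \<bullet> (0, z))\<^sup>2))
          \<in> borel_measurable lebesgue"
        by (intro borel_measurable_scaleR borel_measurable_indicator) simp
    qed
    have "(LINT X:ball 0 R|lebesgue. (a X + b X) * (?G X \<bullet> (0, z))\<^sup>2)
        \<le> (LINT X:ball 0 R|lebesgue. (P - 1) * (norm z)\<^sup>2 * D X)"
      unfolding set_lebesgue_integral_def
    proof (rule integral_mono_AE)
      show "integrable lebesgue (\<lambda>X. indicator (ball 0 R) X *\<^sub>R ((P - 1) * (norm z)\<^sup>2 * D X))"
        using set_integrable_mult_right[OF D_int, of "(P - 1) * (norm z)\<^sup>2"]
        unfolding set_integrable_def by simp
      show "AE X in lebesgue. indicator (ball 0 R) X *\<^sub>R ((a X + b X) * (?G X \<bullet> (0, z))\<^sup>2)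
          \<le> indicator (ball 0 R) X *\<^sub>R ((P - 1) * (norm z)\<^sup>2 * D X)"
        using le by eventually_elim (auto simp: indicator_def)
    qed (use w_int in \<open>simp add: set_integrable_def\<close>)
    also have "\<dots> = (P - 1) * (norm z)\<^sup>2 * (LINT X:ball 0 R|lebesgue. D X)"
      by simp
    also have "\<dots> \<le> (P - 1) * (norm z)\<^sup>2 * (C\<^sub>o * R\<^sup>2)"
    proof (rule mult_left_mono)
      show "(LINT X:ball 0 R|lebesgue. D X) \<le> C\<^sub>o * R\<^sup>2"
        unfolding D_def using assms(10) R by blast
      \<comment> \<open>P bounds p only almost everywhere, but an inequality between constants that
        holds almost everywhere is true.\<close>
      have "AE x in (lebesgue :: (real^'m) measure). 2 \<le> P"
        using P' st(7) by (auto elim!: eventually_mono intro: order_trans)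
      then have "2 \<le> P" by (rule AE_closed_imp_all) simp
      then show "0 \<le> (P - 1) * (norm z)\<^sup>2" by simp
    qed
    finally show "(LINT X:ball 0 R|lebesgue. (a X + b X) * (?G X \<bullet> (0, z))\<^sup>2)
        \<le> (P - 1) * (norm z)\<^sup>2 * C\<^sub>o * R\<^sup>2" by (simp add: mult.assoc)
  next
    fix \<xi> :: "(real^'m) \<times> (real^'k) \<Rightarrow> real" and Z r
    assume "C1_grad \<xi> Z" "\<And>X. r < norm X \<Longrightarrow> \<xi> X = 0"
    note lin = linearized[OF this]
    show "(LINT X|lebesgue. a X * (H (0, axis y1 1) X \<bullet> Z X)
      + b X * ((sgn (?G X) \<bullet> H (0, axis y1 1) X) * (sgn (?G X) \<bullet> Z X)))
      = (LINT X|lebesgue. deriv (f (fst X)) (u X) * v X * \<xi> X)"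
      unfolding v_def by (rule lin)
    show "(LINT X|lebesgue. a X * (H (0, z) X \<bullet> Z X)
      + b X * ((sgn (?G X) \<bullet> H (0, z) X) * (sgn (?G X) \<bullet> Z X)))
      = (LINT X|lebesgue. deriv (f (fst X)) (u X) * (?G X \<bullet> (0, z)) * \<xi> X)"
      by (rule lin)
  qed (use v_pos a_meas b_meas ab_bd a_pos b_nonneg sgnc in auto)
  then obtain c where c: "\<And>z X. ?G X \<bullet> (0, z) = c z * v X" by metis
  \<comment> \<open>The coordinates of d are the proportionality factors of the partial derivatives
    in y to v. If d were 0, the y-gradient and with it v would vanish.\<close>
  define d where "d = (\<chi> i. c (axis i 1))"
  have "snd (?G X) = v X *\<^sub>R d" for X
    using c[of X "axis _ 1"]
    by (simp add: vec_eq_iff d_def inner_prod_def inner_axis mult.commute)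
  moreover from this[of 0] have "d \<noteq> 0"
    using v_pos[of 0] by (auto simp: v_def inner_prod_def)
  ultimately show ?thesis
    by (rule frechet_proportional_imp_one_dimensional[OF u])
qed

end
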